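(* Consider the \textsc{Threshold}-$v$ problem in the noisy value model. Let $\varepsilon>0$ be a constant. Fix an arbitrary set $X$ of $n$ elements with values $v_1,\dots,v_n$ such that the number $\ell$ of distinct values satisfies $\ell=O(n^{1-\varepsilon})$, and let $k_v$ be the number of elements with value at least $v$. Then any algorithm that solves the problem with correctness probability at least $2/3$ on every input, even with prior knowledge of the multiset of values $\{v_1,\dots,v_n\}$ (but not of which element holds which value) and with no constraint on the number of rounds, has query complexity $\Omega\left(n+n\log(\min\{k_v,n-k_v\})\right)$ on (some permutation of) this instance.
   Context: \textsc{Threshold}-$v$ problem: given elements carrying values and a threshold $v$, output exactly the elements whose value is at least $v$. Noisy value model: a query about element $i$ returns its true value with probability $2/3$ and an arbitrary (adversarial) value otherwise. The instance-optimal query complexity of an instance $J$ is $\inf_{A}\sup_{I}$ (query complexity of $A$ on $I$), where $A$ ranges over algorithms correct with probability at least $2/3$ on every input and $I$ ranges over permutations of $J$. *)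

theory Defs
  imports "HOL-Probability.Probability" "HOL-Library.Multiset"
begin

text \<open>
  An instance with \<open>n\<close> elements is a list \<open>xs\<close> of length \<open>n\<close>: element \<open>i < n\<close> carries the
  value \<open>xs ! i\<close>. The permutations of \<open>xs\<close> are the lists \<open>ys\<close> with \<open>mset ys = mset xs\<close>.
\<close>

definition threshold_set :: "real \<Rightarrow> real list \<Rightarrow> nat set" where
  "threshold_set v xs = {i. i < length xs \<and> v \<le> xs ! i}"

definition num_ge :: "real \<Rightarrow> real list \<Rightarrow> nat" where
  "num_ge v xs = card (threshold_set v xs)"

type_synonym history = "(nat \<times> real) list"

datatype action = Query nat | Output "nat set"

text \<open>
  A fully adaptive randomized algorithm chooses its next action at random depending on all
  queries and answers seen so far (oldest first). There are only countably many sensible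
  actions, so discrete distributions lose no generality. The adversary chooses the value
  returned when a query is answered wrongly; it is a function of the history, may randomize,
  and may depend on the instance and on the algorithm because it is always quantified after them.
\<close>

type_synonym algorithm = "history \<Rightarrow> action pmf"

type_synonym adversary = "history \<Rightarrow> nat \<Rightarrow> real pmf"

definition algorithm_on :: "nat \<Rightarrow> algorithm \<Rightarrow> bool" where
  "algorithm_on n A \<longleftrightarrow> (\<forall>h i. Query i \<in> set_pmf (A h) \<longrightarrow> i < n)"

definition noisy_answer :: "real list \<Rightarrow> adversary \<Rightarrow> history \<Rightarrow> nat \<Rightarrow> real pmf" where
  "noisy_answer xs adv h i =
     bind_pmf (bernoulli_pmf (2/3)) (\<lambda>b. if b then return_pmf (xs ! i) else adv h i)"

text \<open>
  State after \<open>t\<close> steps: the history and, once the algorithm has stopped, its output.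
  Every step of an algorithm that has not stopped is either one query or the output.
\<close>

primrec run :: "algorithm \<Rightarrow> adversary \<Rightarrow> real list \<Rightarrow> nat \<Rightarrow> (history \<times> nat set option) pmf" where
  "run A adv xs 0 = return_pmf ([], None)"
| "run A adv xs (Suc t) =
     bind_pmf (run A adv xs t) (\<lambda>(h, out).
       case out of
         Some S \<Rightarrow> return_pmf (h, Some S)
       | None \<Rightarrow> bind_pmf (A h) (\<lambda>a.
           case a of
             Output S \<Rightarrow> return_pmf (h, Some S)
           | Query i \<Rightarrow> map_pmf (\<lambda>y. (h @ [(i, y)], None)) (noisy_answer xs adv h i)))"

text \<open>
  Both suprema over \<open>t\<close> are limits of nondecreasing sequences. Runs that never stop count as
  failures and contribute infinitely many queries.
\<close>

definition success_prob :: "algorithm \<Rightarrow> adversary \<Rightarrow> real \<Rightarrow> real list \<Rightarrow> real" where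
  "success_prob A adv v xs =
     (SUP t. measure_pmf.prob (run A adv xs t) {(h, out). out = Some (threshold_set v xs)})"

definition solves_threshold :: "algorithm \<Rightarrow> real \<Rightarrow> real list \<Rightarrow> bool" where
  "solves_threshold A v xs \<longleftrightarrow> (\<forall>adv. 2/3 \<le> success_prob A adv v xs)"

definition expected_queries :: "algorithm \<Rightarrow> adversary \<Rightarrow> real list \<Rightarrow> ennreal" where
  "expected_queries A adv xs =
     (SUP t. \<integral>\<^sup>+ s. of_nat (length (fst s)) \<partial>measure_pmf (run A adv xs t))"

definition query_complexity :: "algorithm \<Rightarrow> real list \<Rightarrow> ennreal" where
  "query_complexity A xs = (SUP adv. expected_queries A adv xs)"

text \<open>
  Correctness on every input of the given size, respectively on every input that is consistent
  with prior knowledge of the multiset of values.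
\<close>

definition correct_on_all_inputs :: "algorithm \<Rightarrow> real \<Rightarrow> nat \<Rightarrow> bool" where
  "correct_on_all_inputs A v n \<longleftrightarrow> (\<forall>ys. length ys = n \<longrightarrow> solves_threshold A v ys)"

definition correct_given_multiset :: "algorithm \<Rightarrow> real \<Rightarrow> real multiset \<Rightarrow> bool" where
  "correct_given_multiset A v M \<longleftrightarrow> (\<forall>ys. mset ys = M \<longrightarrow> solves_threshold A v ys)"

end

theory Submission
  imports Defs "HOL-Combinatorics.Multiset_Permutations" "HOL-Real_Asymp.Real_Asymp"
begin

text \<open>
  Hide the values behind persistent fakes: a location either answers honestly or, when lying,
  always returns one fake value drawn from the empirical distribution of the values. Call a liar
  whose first \<open>q\<close> answers are all lies a \<^emph>\<open>deceiver\<close>, and a location \<^emph>\<open>late\<close> once it has been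
  queried more than \<open>q\<close> times. Until it is late, a deceiver answers independently of its true
  value, so over a random permutation the true values on the deceivers that are not late are
  exchangeable. If both a high and a low value occur there, swapping them shows that the output
  is wrong with conditional probability at least \<open>1/2\<close>. As long as only a small fraction of the
  deceivers is late, exchangeability also makes it unlikely that these are all the deceivers with
  a high value, or all those with a low one.

  A location is a deceiver with probability about \<open>3\<^sup>-\<^sup>q\<close>, so \<open>q\<close> may be a small multiple of
  \<open>log (min k (n - k))\<close>. An algorithm with too few queries makes only a small fraction of all
  locations late, and it must not find most deceivers among them. If the values at the locations
  were independent, a location about to become late would be a deceiver with probability
  \<open>O(3\<^sup>-\<^sup>q)\<close> whatever has been seen, which gives a failure probability
  \<open>exp (- \<Omega>(n 3\<^sup>-\<^sup>q))\<close>. Conditioning on the multiset of values costs a factor \<open>(e n)\<^sup>\<ell>\<close>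
  where \<open>\<ell>\<close> is the number of distinct values. This is affordable because \<open>\<ell> = O(n\<^sup>1\<^sup>-\<^sup>\<epsilon>)\<close>.
\<close>

section \<open>Runs against persistent fakes\<close>

type_synonym run_state = "history \<times> nat set option"

definition query_step ::
    "algorithm \<Rightarrow> real set \<Rightarrow> (run_state \<Rightarrow> ennreal) \<Rightarrow> run_state \<Rightarrow> ennreal"
  where "query_step A V \<phi> s =
    (case snd s of
       Some S \<Rightarrow> \<phi> s
     | None \<Rightarrow> \<integral>\<^sup>+ a. (case a of
           Output S \<Rightarrow> \<phi> (fst s, Some S)
         | Query i \<Rightarrow> \<Sum>y\<in>V. \<phi> (fst s @ [(i, y)], None)) \<partial>measure_pmf (A (fst s)))"

text \<open>
  \<open>path_sum A V t \<phi>\<close> sums \<open>\<phi>\<close> over all states after \<open>t\<close> steps with answers in \<open>V\<close>, weighted only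
  by the probabilities of the algorithm's own choices. All answer models become densities for it.
\<close>

primrec path_sum ::
    "algorithm \<Rightarrow> real set \<Rightarrow> nat \<Rightarrow> (run_state \<Rightarrow> ennreal) \<Rightarrow> ennreal" where
  "path_sum A V 0 \<phi> = \<phi> ([], None)"
| "path_sum A V (Suc t) \<phi> = path_sum A V t (query_step A V \<phi>)"

lemma query_step_mono:
  assumes "\<And>s. \<phi> s \<le> \<psi> s"
  shows "query_step A V \<phi> s \<le> query_step A V \<psi> s"
  unfolding query_step_def
  by (auto split: option.split action.split intro!: assms nn_integral_mono sum_mono)

lemma path_sum_mono:
  assumes "\<And>s. \<phi> s \<le> \<psi> s"
  shows "path_sum A V t \<phi> \<le> path_sum A V t \<psi>"
  using assms by (induction t arbitrary: \<phi> \<psi>) (simp_all add: query_step_mono)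

lemma query_step_add:
  "query_step A V (\<lambda>s. \<phi> s + \<psi> s) s = query_step A V \<phi> s + query_step A V \<psi> s"
  unfolding query_step_def
  by (auto split: option.split simp: nn_integral_add[symmetric] sum.distrib
      intro!: nn_integral_cong split: action.split)

lemma path_sum_add:
  "path_sum A V t (\<lambda>s. \<phi> s + \<psi> s) = path_sum A V t \<phi> + path_sum A V t \<psi>"
  by (induction t arbitrary: \<phi> \<psi>) (simp_all add: query_step_add[abs_def])

lemma query_step_cmult:
  "query_step A V (\<lambda>s. c * \<phi> s) s = c * query_step A V \<phi> s"
  unfolding query_step_def
  by (auto split: option.split simp: nn_integral_cmult[symmetric] sum_distrib_left
      intro!: nn_integral_cong split: action.split)

lemma path_sum_cmult:
  "path_sum A V t (\<lambda>s. c * \<phi> s) = c * path_sum A V t \<phi>"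
  by (induction t arbitrary: \<phi>) (simp_all add: query_step_cmult[abs_def])

lemma path_sum_sum:
  assumes "finite I"
  shows "path_sum A V t (\<lambda>s. \<Sum>j\<in>I. \<phi> j s) = (\<Sum>j\<in>I. path_sum A V t (\<phi> j))"
  using assms
proof (induction I)
  case empty
  show ?case using path_sum_cmult[of A V t 0 "\<lambda>_. 0"] by simp
qed (simp add: path_sum_add)

lemma query_step_supermartingale:
  assumes queries_valid: "algorithm_on n A"
    and sum_answers_le: "\<And>h i. i < n \<Longrightarrow> (\<Sum>y\<in>V. W (h @ [(i, y)])) \<le> W h"
  shows "query_step A V (\<lambda>s. W (fst s)) s \<le> W (fst s)"
proof (cases "snd s")
  case None
  then have "query_step A V (\<lambda>s. W (fst s)) s =
      (\<integral>\<^sup>+ a. (case a of Output S \<Rightarrow> W (fst s)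
         | Query i \<Rightarrow> \<Sum>y\<in>V. W (fst s @ [(i, y)])) \<partial>measure_pmf (A (fst s)))"
    by (simp add: query_step_def)
  also have "\<dots> \<le> (\<integral>\<^sup>+ a. W (fst s) \<partial>measure_pmf (A (fst s)))"
    using queries_valid sum_answers_le
    by (intro nn_integral_mono_AE)
      (auto simp: AE_measure_pmf_iff algorithm_on_def split: action.split)
  finally show ?thesis by simp
qed (simp add: query_step_def)

lemma path_sum_supermartingale:
  fixes W :: "history \<Rightarrow> real"
  assumes queries_valid: "algorithm_on n A"
    and nonneg: "\<And>h. 0 \<le> W h"
    and sum_answers_le: "\<And>h i. i < n \<Longrightarrow> (\<Sum>y\<in>V. W (h @ [(i, y)])) \<le> W h"
  shows "path_sum A V t (\<lambda>s. ennreal (W (fst s))) \<le> ennreal (W [])"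
proof (induction t)
  case (Suc t)
  have "query_step A V (\<lambda>s. ennreal (W (fst s))) s \<le> ennreal (W (fst s))" for s
    by (rule query_step_supermartingale[OF queries_valid])
      (simp add: nonneg sum_answers_le ennreal_leI)
  then have "path_sum A V (Suc t) (\<lambda>s. ennreal (W (fst s)))
      \<le> path_sum A V t (\<lambda>s. ennreal (W (fst s)))"
    by (simp add: path_sum_mono)
  then show ?case using Suc.IH by (rule order_trans)
qed simp

definition responses :: "nat \<Rightarrow> history \<Rightarrow> real list" where
  "responses i h = map snd (filter (\<lambda>p. fst p = i) h)"

lemma responses_Nil [simp]: "responses i [] = []"
  by (simp add: responses_def)

lemma responses_snoc:
  "responses j (h @ [(i, y)]) = (if j = i then responses i h @ [y] else responses j h)"
  by (simp add: responses_def)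

lemma sum_length_responses_le:
  assumes "finite I"
  shows "(\<Sum>i\<in>I. length (responses i h)) \<le> length h"
proof (induction h rule: rev_induct)
  case (snoc query h)
  obtain i y where query: "query = (i, y)" by force
  have "(\<Sum>j\<in>I. length (responses j (h @ [(i, y)]))) =
      (\<Sum>j\<in>I. length (responses j h) + (if j = i then 1 else 0))"
    by (intro sum.cong) (auto simp: responses_snoc)
  also have "\<dots> \<le> (\<Sum>j\<in>I. length (responses j h)) + 1"
    using assms by (simp add: sum.distrib)
  finally show ?case using snoc.IH query by simp
qed simp

lemma prod_responses_snoc:
  fixes \<phi> :: "nat \<Rightarrow> real list \<Rightarrow> 'a :: comm_monoid_mult"
  assumes "i < n"
  shows "(\<Prod>j<n. \<phi> j (responses j (h @ [(i, y)]))) =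
    \<phi> i (responses i h @ [y]) * (\<Prod>j\<in>{..<n} - {i}. \<phi> j (responses j h))"
  using assms
  by (subst prod.remove[of _ i])
    (auto simp: responses_snoc intro!: arg_cong2[where f = "(*)"] prod.cong)

lemma sum_prod_responses_snoc:
  fixes \<phi> :: "nat \<Rightarrow> real list \<Rightarrow> 'a :: comm_semiring_1"
  assumes "i < n"
  shows "(\<Sum>y\<in>V. \<Prod>j<n. \<phi> j (responses j (h @ [(i, y)]))) =
    (\<Sum>y\<in>V. \<phi> i (responses i h @ [y])) * (\<Prod>j\<in>{..<n} - {i}. \<phi> j (responses j h))"
  by (simp add: prod_responses_snoc[OF assms] sum_distrib_right)

definition persistent_adv :: "(nat \<Rightarrow> real) \<Rightarrow> adversary" where
  "persistent_adv f = (\<lambda>h i. return_pmf (f i))"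

definition answer_prob :: "'a \<Rightarrow> 'a \<Rightarrow> 'a \<Rightarrow> real" where
  "answer_prob x f y = 2/3 * of_bool (y = x) + 1/3 * of_bool (y = f)"

definition likelihood :: "'a \<Rightarrow> 'a \<Rightarrow> 'a list \<Rightarrow> real" where
  "likelihood x f r = prod_list (map (answer_prob x f) r)"

lemma answer_prob_nonneg: "0 \<le> answer_prob x f y"
  by (simp add: answer_prob_def)

lemma sum_answer_prob:
  assumes "finite V" "x \<in> V" "f \<in> V"
  shows "(\<Sum>y\<in>V. answer_prob x f y) = 1"
proof -
  have "(\<Sum>y\<in>V. answer_prob x f y) =
      (\<Sum>y\<in>V. if y = x then 2/3 else 0) + (\<Sum>y\<in>V. if y = f then 1/3 else 0)"
    unfolding sum.distrib[symmetric] by (intro sum.cong) (auto simp: answer_prob_def)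
  then show ?thesis using assms by simp
qed

lemma likelihood_Nil [simp]: "likelihood x f [] = 1"
  by (simp add: likelihood_def)

lemma likelihood_Cons: "likelihood x f (y # r) = answer_prob x f y * likelihood x f r"
  by (simp add: likelihood_def)

lemma likelihood_append: "likelihood x f (r @ r') = likelihood x f r * likelihood x f r'"
  by (simp add: likelihood_def)

lemma likelihood_snoc: "likelihood x f (r @ [y]) = likelihood x f r * answer_prob x f y"
  by (simp add: likelihood_def)

lemma likelihood_nonneg: "0 \<le> likelihood x f r"
  by (induction r) (auto simp: likelihood_Cons answer_prob_nonneg)

lemma likelihood_honest: "likelihood x x r = of_bool (\<forall>y\<in>set r. y = x)"
  by (induction r) (auto simp: likelihood_Cons answer_prob_def)

lemma likelihood_all_fake_ge:
  assumes "\<forall>y\<in>set r. y = f"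
  shows "(1/3) ^ length r \<le> likelihood x f r"
  using assms
proof (induction r)
  case (Cons y r)
  then have "(1/3) * (1/3) ^ length r \<le> answer_prob x f y * likelihood x f r"
    by (intro mult_mono) (auto simp: answer_prob_def)
  then show ?case by (simp add: likelihood_Cons)
qed simp

definition history_likelihood :: "nat \<Rightarrow> real list \<Rightarrow> (nat \<Rightarrow> real) \<Rightarrow> history \<Rightarrow> real" where
  "history_likelihood n ys f h = (\<Prod>i<n. likelihood (ys ! i) (f i) (responses i h))"

lemma history_likelihood_Nil [simp]: "history_likelihood n ys f [] = 1"
  by (simp add: history_likelihood_def)

lemma history_likelihood_nonneg: "0 \<le> history_likelihood n ys f h"
  by (simp add: history_likelihood_def prod_nonneg likelihood_nonneg)

lemma history_likelihood_snoc:
  assumes "i < n"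
  shows "history_likelihood n ys f (h @ [(i, y)]) =
    history_likelihood n ys f h * answer_prob (ys ! i) (f i) y"
  unfolding history_likelihood_def using assms
  by (subst prod_responses_snoc[OF assms]) (simp add: likelihood_snoc prod.remove[of "{..<n}" i])

lemma nn_integral_noisy_answer_persistent_adv:
  assumes "finite V" "ys ! i \<in> V" "f i \<in> V"
  shows "(\<integral>\<^sup>+ y. g y \<partial>noisy_answer ys (persistent_adv f) h i) =
    (\<Sum>y\<in>V. ennreal (answer_prob (ys ! i) (f i) y) * g y)"
proof -
  have "pmf (noisy_answer ys (persistent_adv f) h i) y = answer_prob (ys ! i) (f i) y" for y
    unfolding noisy_answer_def persistent_adv_def
    by (simp add: pmf_bind answer_prob_def indicator_def of_bool_def eq_commute)
  moreover have "(\<integral>\<^sup>+ y. g y \<partial>noisy_answer ys (persistent_adv f) h i) =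
      (\<Sum>y\<in>V. g y * pmf (noisy_answer ys (persistent_adv f) h i) y)"
    using assms
    by (intro nn_integral_measure_pmf_support)
      (auto simp: noisy_answer_def persistent_adv_def split: if_splits)
  ultimately show ?thesis by (simp add: mult.commute)
qed

definition run_step ::
    "algorithm \<Rightarrow> adversary \<Rightarrow> real list \<Rightarrow> run_state \<Rightarrow> run_state pmf"
  where "run_step A adv xs s =
    (case snd s of
       Some S \<Rightarrow> return_pmf s
     | None \<Rightarrow> bind_pmf (A (fst s)) (\<lambda>a. case a of
           Output S \<Rightarrow> return_pmf (fst s, Some S)
         | Query i \<Rightarrow> map_pmf (\<lambda>y. (fst s @ [(i, y)], None)) (noisy_answer xs adv (fst s) i)))"

lemma run_Suc_eq_bind_run_step:
  "run A adv xs (Suc t) = bind_pmf (run A adv xs t) (run_step A adv xs)"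
  by (auto simp: run_step_def split_beta' intro!: bind_pmf_cong split: option.split action.split)

lemma query_step_history_likelihood:
  assumes queries_valid: "algorithm_on n A" and finite_V: "finite V"
    and truths: "\<And>i. i < n \<Longrightarrow> ys ! i \<in> V" and fakes: "\<And>i. i < n \<Longrightarrow> f i \<in> V"
  shows "query_step A V (\<lambda>s. ennreal (history_likelihood n ys f (fst s)) * \<phi> s) s =
    ennreal (history_likelihood n ys f (fst s))
        * (\<integral>\<^sup>+ s'. \<phi> s' \<partial>run_step A (persistent_adv f) ys s)"
proof (cases "snd s")
  case None
  let ?L = "\<lambda>h. ennreal (history_likelihood n ys f h)" and ?h = "fst s"
  have query: "(\<Sum>y\<in>V. ?L (?h @ [(i, y)]) * \<phi> (?h @ [(i, y)], None)) =
      ?L ?h * (\<integral>\<^sup>+ y. \<phi> (?h @ [(i, y)], None) \<partial>noisy_answer ys (persistent_adv f) ?h i)"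
    if "i < n" for i
    using that finite_V truths fakes
    by (simp add: nn_integral_noisy_answer_persistent_adv history_likelihood_snoc sum_distrib_left
        ennreal_mult' history_likelihood_nonneg answer_prob_nonneg mult.assoc)
  have "query_step A V (\<lambda>s. ?L (fst s) * \<phi> s) s =
      (\<integral>\<^sup>+ a. (case a of Output S \<Rightarrow> ?L ?h * \<phi> (?h, Some S)
         | Query i \<Rightarrow> \<Sum>y\<in>V. ?L (?h @ [(i, y)]) * \<phi> (?h @ [(i, y)], None)) \<partial>A ?h)"
    by (simp add: query_step_def None)
  also have "\<dots> = (\<integral>\<^sup>+ a. ?L ?h * (case a of Output S \<Rightarrow> \<phi> (?h, Some S)
       | Query i \<Rightarrow> \<integral>\<^sup>+ y. \<phi> (?h @ [(i, y)], None) \<partial>noisy_answer ys (persistent_adv f) ?h i) \<partial>A ?h)"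
    using queries_valid query
    by (intro nn_integral_cong_AE)
      (auto simp: AE_measure_pmf_iff algorithm_on_def split: action.split)
  also have "\<dots> = ?L ?h * (\<integral>\<^sup>+ s'. \<phi> s' \<partial>run_step A (persistent_adv f) ys s)"
    by (auto simp: run_step_def None nn_integral_cmult
        intro!: arg_cong2[where f = "(*)"] nn_integral_cong split: action.split)
  finally show ?thesis .
qed (simp add: query_step_def run_step_def)

lemma nn_integral_run_eq_path_sum:
  assumes "algorithm_on n A" "finite V" "\<And>i. i < n \<Longrightarrow> ys ! i \<in> V" "\<And>i. i < n \<Longrightarrow> f i \<in> V"
  shows "(\<integral>\<^sup>+ s. \<phi> s \<partial>run A (persistent_adv f) ys t) =
    path_sum A V t (\<lambda>s. ennreal (history_likelihood n ys f (fst s)) * \<phi> s)"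
proof (induction t arbitrary: \<phi>)
  case (Suc t)
  have "(\<integral>\<^sup>+ s. \<phi> s \<partial>run A (persistent_adv f) ys (Suc t)) =
      (\<integral>\<^sup>+ s. \<integral>\<^sup>+ s'. \<phi> s' \<partial>run_step A (persistent_adv f) ys s \<partial>run A (persistent_adv f) ys t)"
    unfolding run_Suc_eq_bind_run_step by simp
  moreover have "query_step A V (\<lambda>s. ennreal (history_likelihood n ys f (fst s)) * \<phi> s) =
      (\<lambda>s. ennreal (history_likelihood n ys f (fst s)) *
        (\<integral>\<^sup>+ s'. \<phi> s' \<partial>run_step A (persistent_adv f) ys s))"
    by (intro ext query_step_history_likelihood assms)
  ultimately show ?case by (simp add: Suc.IH del: run.simps)
qed simp

lemma prob_output_run_mono:
  assumes "t \<le> t'"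
  shows "measure_pmf.prob (run A adv ys t) {s. snd s = Some S}
    \<le> measure_pmf.prob (run A adv ys t') {s. snd s = Some S}"
  using assms
proof (induction t' rule: dec_induct)
  case (step t')
  let ?stopped = "{s :: run_state. snd s = Some S}"
  have "emeasure (run A adv ys t') ?stopped = (\<integral>\<^sup>+ s. indicator ?stopped s \<partial>run A adv ys t')"
    by simp
  also have "\<dots> \<le> (\<integral>\<^sup>+ s. emeasure (run_step A adv ys s) ?stopped \<partial>run A adv ys t')"
    by (intro nn_integral_mono) (auto simp: run_step_def indicator_def)
  also have "\<dots> = emeasure (run A adv ys (Suc t')) ?stopped"
    unfolding run_Suc_eq_bind_run_step by simp
  finally show ?case
    using step.IH by (simp add: measure_pmf.emeasure_eq_measure del: run.simps)
qed simp

definition correct_states :: "real \<Rightarrow> real list \<Rightarrow> run_state set" where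
  "correct_states v ys = {s. snd s = Some (threshold_set v ys)}"

lemma solves_threshold_eventually:
  assumes "solves_threshold A v ys" "p < 2/3"
  shows "\<forall>\<^sub>F t in sequentially.
    p \<le> measure_pmf.prob (run A adv ys t) (correct_states v ys)"
proof -
  let ?correct = "\<lambda>t. measure_pmf.prob (run A adv ys t) (correct_states v ys)"
  have "2/3 \<le> (SUP t. ?correct t)"
    using assms(1) unfolding solves_threshold_def success_prob_def correct_states_def
    by (simp add: case_prod_unfold)
  with assms(2) have "p < (SUP t. ?correct t)" by linarith
  moreover have "bdd_above (range ?correct)"
    by (intro bdd_aboveI[of _ 1]) auto
  ultimately obtain t where "p < ?correct t"
    by (auto simp: less_cSUP_iff)
  then have "p \<le> ?correct t'" if "t \<le> t'" for t'
    using prob_output_run_mono[OF that, of A adv ys "threshold_set v ys"]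
    by (simp add: correct_states_def)
  then show ?thesis unfolding eventually_sequentially by blast
qed

lemma nn_integral_length_le_query_complexity:
  "(\<integral>\<^sup>+ s. of_nat (length (fst s)) \<partial>run A adv ys t) \<le> query_complexity A ys"
  unfolding query_complexity_def expected_queries_def by (intro SUP_upper2[of adv] SUP_upper) auto

section \<open>Deceivers\<close>

lemma prod_add_eq_sum_Pow_if:
  fixes a b :: "'a \<Rightarrow> 'b :: comm_semiring_1"
  assumes "finite I"
  shows "(\<Prod>i\<in>I. a i + b i) = (\<Sum>G\<in>Pow I. \<Prod>i\<in>I. if i \<in> G then a i else b i)"
proof -
  have "(\<Prod>i\<in>I. if i \<in> G then a i else b i) = (\<Prod>i\<in>G. a i) * (\<Prod>i\<in>I - G. b i)" if "G \<subseteq> I" for G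
  proof -
    have "I \<inter> G = G" "I \<inter> - G = I - G" using that by auto
    then show ?thesis using assms prod.If_cases[of I "\<lambda>i. i \<in> G" a b] by simp
  qed
  then show ?thesis using assms by (simp add: prod_add)
qed

text \<open>
  A location lies with probability \<open>\<kappa>\<close>, and its fake value has distribution \<open>\<mu>\<close>. Whether its first
  \<open>q\<close> answers are all lies is decided in advance, so this has probability \<open>3\<^sup>-\<^sup>q\<close> however few of them
  are ever asked for.
\<close>

locale noise_model =
  fixes n :: nat and V :: "real set" and \<mu> :: "real \<Rightarrow> real" and \<kappa> :: real and q :: nat
  assumes finite_V: "finite V"
    and \<mu>_nonneg: "f \<in> V \<Longrightarrow> 0 \<le> \<mu> f"
    and sum_\<mu>: "sum \<mu> V = 1"
    and \<kappa>_nonneg: "0 \<le> \<kappa>"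
    and \<kappa>_le_1: "\<kappa> \<le> 1"
begin

definition deceiver_prob :: real where
  "deceiver_prob = \<kappa> * (1/3) ^ q"

definition deceit_lik :: "real \<Rightarrow> real \<Rightarrow> real list \<Rightarrow> real" where
  "deceit_lik x f r = (1/3) ^ q * of_bool (\<forall>y\<in>set (take q r). y = f) * likelihood x f (drop q r)"

definition total_lik :: "real \<Rightarrow> real list \<Rightarrow> real" where
  "total_lik x r = (1 - \<kappa>) * likelihood x x r + \<kappa> * (\<Sum>f\<in>V. \<mu> f * likelihood x f r)"

definition deceiver_lik :: "real \<Rightarrow> real list \<Rightarrow> real" where
  "deceiver_lik x r = \<kappa> * (\<Sum>f\<in>V. \<mu> f * deceit_lik x f r)"

definition other_lik :: "real \<Rightarrow> real list \<Rightarrow> real" where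
  "other_lik x r = total_lik x r - deceiver_lik x r"

lemma deceiver_prob_nonneg: "0 \<le> deceiver_prob"
  using \<kappa>_nonneg by (simp add: deceiver_prob_def)

lemma deceiver_prob_le_1: "deceiver_prob \<le> 1"
  using \<kappa>_le_1 \<kappa>_nonneg by (auto simp: deceiver_prob_def power_le_one intro: mult_le_one)

lemma total_lik_Nil [simp]: "total_lik x [] = 1"
  by (simp add: total_lik_def sum_\<mu>)

lemma deceiver_lik_Nil [simp]: "deceiver_lik x [] = deceiver_prob"
  using sum_\<mu>
  by (simp add: deceiver_lik_def deceit_lik_def deceiver_prob_def flip: sum_distrib_right)

lemma other_lik_Nil [simp]: "other_lik x [] = 1 - deceiver_prob"
  by (simp add: other_lik_def)

lemma deceit_lik_nonneg: "0 \<le> deceit_lik x f r"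
  by (simp add: deceit_lik_def likelihood_nonneg)

lemma deceit_lik_le_likelihood: "deceit_lik x f r \<le> likelihood x f r"
proof -
  have "(1/3) ^ q * of_bool (\<forall>y\<in>set (take q r). y = f) \<le> likelihood x f (take q r)"
  proof (cases "\<forall>y\<in>set (take q r). y = f")
    case True
    have "(1/3 :: real) ^ q \<le> (1/3) ^ length (take q r)"
      by (intro power_decreasing) auto
    also have "\<dots> \<le> likelihood x f (take q r)"
      using True by (rule likelihood_all_fake_ge)
    finally show ?thesis using True by simp
  qed (auto simp: likelihood_nonneg)
  then have "deceit_lik x f r \<le> likelihood x f (take q r) * likelihood x f (drop q r)"
    unfolding deceit_lik_def by (intro mult_right_mono likelihood_nonneg)
  then show ?thesis by (simp flip: likelihood_append)
qed

lemma deceiver_lik_nonneg: "0 \<le> deceiver_lik x r"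
  unfolding deceiver_lik_def
  by (intro mult_nonneg_nonneg sum_nonneg \<kappa>_nonneg \<mu>_nonneg deceit_lik_nonneg)

lemma deceiver_lik_le_total_lik: "deceiver_lik x r \<le> total_lik x r"
proof -
  have "deceiver_lik x r \<le> \<kappa> * (\<Sum>f\<in>V. \<mu> f * likelihood x f r)"
    unfolding deceiver_lik_def
    by (intro mult_left_mono sum_mono \<kappa>_nonneg \<mu>_nonneg deceit_lik_le_likelihood)
  also have "\<dots> \<le> total_lik x r"
    using \<kappa>_le_1 by (simp add: total_lik_def likelihood_nonneg)
  finally show ?thesis .
qed

lemma other_lik_nonneg: "0 \<le> other_lik x r"
  using deceiver_lik_le_total_lik by (simp add: other_lik_def)

lemma deceiver_lik_short_cong: "length r \<le> q \<Longrightarrow> deceiver_lik x r = deceiver_lik x' r"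
  by (simp add: deceiver_lik_def deceit_lik_def)

lemma sum_likelihood_snoc:
  assumes "x \<in> V" "f \<in> V"
  shows "(\<Sum>y\<in>V. likelihood x f (r @ [y])) = likelihood x f r"
  using assms finite_V by (simp add: likelihood_snoc sum_answer_prob flip: sum_distrib_left)

lemma sum_deceit_lik_snoc:
  assumes "x \<in> V" "f \<in> V"
  shows "(\<Sum>y\<in>V. deceit_lik x f (r @ [y])) = deceit_lik x f r"
proof (cases "q \<le> length r")
  case True
  then show ?thesis
    using assms by (simp add: deceit_lik_def sum_likelihood_snoc flip: sum_distrib_left)
next
  case False
  then have "(\<Sum>y\<in>V. deceit_lik x f (r @ [y])) = (\<Sum>y\<in>V. if y = f then deceit_lik x f r else 0)"
    by (intro sum.cong) (auto simp: deceit_lik_def)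
  then show ?thesis using assms finite_V by simp
qed

lemma sum_total_lik_snoc:
  assumes "x \<in> V"
  shows "(\<Sum>y\<in>V. total_lik x (r @ [y])) = total_lik x r"
  using assms
  by (simp add: total_lik_def sum.distrib sum_likelihood_snoc sum.swap[of _ V V]
      flip: sum_distrib_left)

lemma sum_deceiver_lik_snoc:
  assumes "x \<in> V"
  shows "(\<Sum>y\<in>V. deceiver_lik x (r @ [y])) = deceiver_lik x r"
proof -
  have "(\<Sum>y\<in>V. \<Sum>f\<in>V. \<mu> f * deceit_lik x f (r @ [y])) = (\<Sum>f\<in>V. \<mu> f * deceit_lik x f r)"
    using assms by (subst sum.swap) (simp add: sum_deceit_lik_snoc flip: sum_distrib_left)
  then show ?thesis by (simp add: deceiver_lik_def flip: sum_distrib_left)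
qed

lemma sum_other_lik_snoc: "x \<in> V \<Longrightarrow> (\<Sum>y\<in>V. other_lik x (r @ [y])) = other_lik x r"
  by (simp add: other_lik_def sum_subtractf sum_total_lik_snoc sum_deceiver_lik_snoc)

text \<open>Likelihood of the history together with \<open>G\<close> being the set of deceivers.\<close>

definition joint_lik :: "nat set \<Rightarrow> real list \<Rightarrow> history \<Rightarrow> real" where
  "joint_lik G ys h =
    (\<Prod>i<n. if i \<in> G then deceiver_lik (ys ! i) (responses i h)
        else other_lik (ys ! i) (responses i h))"

definition deceiver_set_prob :: "nat set \<Rightarrow> real" where
  "deceiver_set_prob G = (\<Prod>i<n. if i \<in> G then deceiver_prob else 1 - deceiver_prob)"

lemma joint_lik_nonneg: "0 \<le> joint_lik G ys h"
  by (auto simp: joint_lik_def intro!: prod_nonneg deceiver_lik_nonneg other_lik_nonneg)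

lemma joint_lik_Nil [simp]: "joint_lik G ys [] = deceiver_set_prob G"
  by (simp add: joint_lik_def deceiver_set_prob_def cong: if_cong)

lemma sum_joint_lik:
  "(\<Sum>G\<in>Pow {..<n}. joint_lik G ys h) = (\<Prod>i<n. total_lik (ys ! i) (responses i h))"
proof -
  have "(\<Prod>i<n. total_lik (ys ! i) (responses i h)) =
      (\<Prod>i<n. deceiver_lik (ys ! i) (responses i h) + other_lik (ys ! i) (responses i h))"
    by (simp add: other_lik_def)
  then show ?thesis by (simp add: joint_lik_def prod_add_eq_sum_Pow_if)
qed

lemma sum_joint_lik_snoc:
  assumes "i < n" "ys ! i \<in> V"
  shows "(\<Sum>y\<in>V. joint_lik G ys (h @ [(i, y)])) = joint_lik G ys h"
  unfolding joint_lik_def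
  by (subst sum_prod_responses_snoc[OF assms(1), of
        "\<lambda>j r. if j \<in> G then deceiver_lik (ys ! j) r else other_lik (ys ! j) r"])
    (use assms in \<open>simp add: sum_deceiver_lik_snoc sum_other_lik_snoc prod.remove[of "{..<n}" i]\<close>)

lemma deceiver_set_prob_nonneg: "0 \<le> deceiver_set_prob G"
  using deceiver_prob_nonneg deceiver_prob_le_1
  by (auto simp: deceiver_set_prob_def intro!: prod_nonneg)

lemma sum_deceiver_set_prob: "(\<Sum>G\<in>Pow {..<n}. deceiver_set_prob G) = 1"
  using sum_joint_lik[of undefined "[]"] by simp

lemma sum_deceiver_set_prob_disjoint:
  assumes "H \<subseteq> {..<n}"
  shows "(\<Sum>G\<in>Pow {..<n}. deceiver_set_prob G * of_bool (G \<inter> H = {})) = (1 - deceiver_prob) ^ card H"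
proof -
  have "deceiver_set_prob G * of_bool (G \<inter> H = {}) =
      (\<Prod>i<n. if i \<in> G then deceiver_prob * of_bool (i \<notin> H) else 1 - deceiver_prob)"
    if "G \<subseteq> {..<n}" for G
  proof (cases "G \<inter> H = {}")
    case True
    then show ?thesis by (auto simp: deceiver_set_prob_def intro!: prod.cong)
  next
    case False
    then obtain i where "i \<in> G" "i \<in> H" "i < n" using assms by (auto simp: subset_eq)
    then have "(\<Prod>i<n. if i \<in> G then deceiver_prob * of_bool (i \<notin> H) else 1 - deceiver_prob) = 0"
      by (intro prod_zero) auto
    then show ?thesis using False by simp
  qed
  then have "(\<Sum>G\<in>Pow {..<n}. deceiver_set_prob G * of_bool (G \<inter> H = {})) =
      (\<Prod>i<n. deceiver_prob * of_bool (i \<notin> H) + (1 - deceiver_prob))"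
    by (simp add: prod_add_eq_sum_Pow_if)
  also have "\<dots> = (\<Prod>i<n. if i \<in> H then 1 - deceiver_prob else 1)"
    by (intro prod.cong) auto
  also have "\<dots> = (1 - deceiver_prob) ^ card H"
    using assms by (simp add: prod.If_cases Int_absorb1)
  finally show ?thesis .
qed

lemma sum_deceiver_set_prob_power_card:
  "(\<Sum>G\<in>Pow {..<n}. deceiver_set_prob G * z ^ card G) = (1 - deceiver_prob + deceiver_prob * z) ^ n"
proof -
  have "deceiver_set_prob G * z ^ card G =
      (\<Prod>i<n. if i \<in> G then deceiver_prob * z else 1 - deceiver_prob)" if "G \<subseteq> {..<n}" for G
  proof -
    have power_card: "z ^ card G = (\<Prod>i<n. if i \<in> G then z else 1)"
      using that by (simp add: prod.If_cases Int_absorb1)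
    show ?thesis
      unfolding deceiver_set_prob_def power_card prod.distrib[symmetric] by (intro prod.cong) auto
  qed
  then have "(\<Sum>G\<in>Pow {..<n}. deceiver_set_prob G * z ^ card G) =
      (\<Prod>i<n. deceiver_prob * z + (1 - deceiver_prob))"
    by (subst prod_add_eq_sum_Pow_if) simp_all
  then show ?thesis by (simp add: add.commute)
qed

lemma sum_deceiver_set_prob_few_le:
  "(\<Sum>G\<in>Pow {..<n}. deceiver_set_prob G * of_bool (real (card G) < g))
    \<le> 2 powr g * (1 - deceiver_prob / 2) ^ n"
proof -
  have "(\<Sum>G\<in>Pow {..<n}. deceiver_set_prob G * of_bool (real (card G) < g))
      \<le> (\<Sum>G\<in>Pow {..<n}. deceiver_set_prob G * (2 powr g * (1/2) ^ card G))"
  proof (intro sum_mono mult_left_mono deceiver_set_prob_nonneg)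
    fix G :: "nat set"
    have "1 \<le> 2 powr (g - real (card G))" if "real (card G) < g"
      using that by (intro ge_one_powr_ge_zero) auto
    then show "of_bool (real (card G) < g) \<le> 2 powr g * (1/2) ^ card G"
      by (auto simp: powr_diff powr_realpow power_one_over)
  qed
  also have "\<dots> = 2 powr g * (\<Sum>G\<in>Pow {..<n}. deceiver_set_prob G * (1/2) ^ card G)"
    by (simp add: sum_distrib_left mult_ac)
  finally show ?thesis by (simp add: sum_deceiver_set_prob_power_card)
qed

definition late :: "history \<Rightarrow> nat set" where
  "late h = {i. i < n \<and> q < length (responses i h)}"

definition typical :: "real \<Rightarrow> real \<Rightarrow> nat set \<Rightarrow> history \<Rightarrow> bool" where
  "typical g m G h \<longleftrightarrow> g \<le> real (card G) \<and> real (card (G \<inter> late h)) \<le> m"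

lemma late_Nil [simp]: "late [] = {}"
  by (simp add: late_def)

lemma late_snoc:
  "i < n \<Longrightarrow> late (h @ [(i, y)]) = (if length (responses i h) = q then insert i (late h) else late h)"
  by (auto simp: late_def responses_snoc split: if_splits)

lemma late_subset: "late h \<subseteq> {..<n}"
  by (auto simp: late_def)

lemma finite_late [simp]: "finite (late h)"
  using finite_subset[OF late_subset] by simp

lemma card_late_le: "(q + 1) * card (late h) \<le> length h"
proof -
  have "(q + 1) * card (late h) = (\<Sum>i\<in>late h. q + 1)" by simp
  also have "\<dots> \<le> (\<Sum>i\<in>late h. length (responses i h))"
    by (intro sum_mono) (auto simp: late_def)
  also have "\<dots> \<le> length h" by (rule sum_length_responses_le) simp
  finally show ?thesis .
qed

text \<open>\<open>None\<close> stands for an honest location, whose ``wrong'' value is its true value.\<close>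

definition fake_choices :: "(nat \<Rightarrow> real option) set" where
  "fake_choices = PiE {..<n} (\<lambda>_. insert None (Some ` V))"

definition choice_prob :: "(nat \<Rightarrow> real option) \<Rightarrow> real" where
  "choice_prob c = (\<Prod>i<n. case c i of None \<Rightarrow> 1 - \<kappa> | Some f \<Rightarrow> \<kappa> * \<mu> f)"

definition wrong_value :: "real list \<Rightarrow> (nat \<Rightarrow> real option) \<Rightarrow> nat \<Rightarrow> real" where
  "wrong_value ys c i = (case c i of None \<Rightarrow> ys ! i | Some f \<Rightarrow> f)"

definition fake_adv :: "real list \<Rightarrow> (nat \<Rightarrow> real option) \<Rightarrow> adversary" where
  "fake_adv ys c = persistent_adv (wrong_value ys c)"

lemma finite_fake_choices: "finite fake_choices"
  using finite_V by (auto simp: fake_choices_def intro: finite_PiE)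

lemma fake_choices_SomeD: "c \<in> fake_choices \<Longrightarrow> i < n \<Longrightarrow> c i = Some f \<Longrightarrow> f \<in> V"
  by (force simp: fake_choices_def PiE_iff)

lemma choice_prob_nonneg: "c \<in> fake_choices \<Longrightarrow> 0 \<le> choice_prob c"
  unfolding choice_prob_def using \<kappa>_nonneg \<kappa>_le_1
  by (intro prod_nonneg)
    (auto split: option.split intro!: mult_nonneg_nonneg \<mu>_nonneg dest: fake_choices_SomeD)

lemma sum_choice_prob_history_likelihood:
  "(\<Sum>c\<in>fake_choices. choice_prob c * history_likelihood n ys (wrong_value ys c) h) =
   (\<Prod>i<n. total_lik (ys ! i) (responses i h))"
proof -
  let ?lik = "\<lambda>i choice. case choice of
      None \<Rightarrow> (1 - \<kappa>) * likelihood (ys ! i) (ys ! i) (responses i h)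
    | Some f \<Rightarrow> \<kappa> * \<mu> f * likelihood (ys ! i) f (responses i h)"
  have "(\<Sum>c\<in>fake_choices. choice_prob c * history_likelihood n ys (wrong_value ys c) h) =
      (\<Sum>c\<in>fake_choices. \<Prod>i<n. ?lik i (c i))"
    unfolding choice_prob_def history_likelihood_def prod.distrib[symmetric] wrong_value_def
    by (intro sum.cong prod.cong) (auto split: option.split)
  also have "\<dots> = (\<Prod>i<n. \<Sum>choice\<in>insert None (Some ` V). ?lik i choice)"
    unfolding fake_choices_def using finite_V by (subst prod_sum_PiE) auto
  also have "\<dots> = (\<Prod>i<n. total_lik (ys ! i) (responses i h))"
    using finite_V
    by (auto simp: total_lik_def sum_distrib_left sum.reindex mult_ac intro!: prod.cong)
  finally show ?thesis .
qed

lemma sum_choice_prob: "(\<Sum>c\<in>fake_choices. choice_prob c) = 1"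
  using sum_choice_prob_history_likelihood[of undefined "[]"] by simp

lemma sum_choice_prob_nn_integral_run:
  assumes "algorithm_on n A" and truths: "\<And>i. i < n \<Longrightarrow> ys ! i \<in> V"
  shows "(\<Sum>c\<in>fake_choices. ennreal (choice_prob c) * (\<integral>\<^sup>+ s. \<phi> s \<partial>run A (fake_adv ys c) ys t)) =
    path_sum A V t (\<lambda>s. ennreal (\<Sum>G\<in>Pow {..<n}. joint_lik G ys (fst s)) * \<phi> s)"
proof -
  have fakes: "wrong_value ys c i \<in> V" if "c \<in> fake_choices" "i < n" for c i
    using that truths by (auto simp: wrong_value_def split: option.split dest: fake_choices_SomeD)
  have "(\<Sum>c\<in>fake_choices. ennreal (choice_prob c) * (\<integral>\<^sup>+ s. \<phi> s \<partial>run A (fake_adv ys c) ys t)) =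
      (\<Sum>c\<in>fake_choices. path_sum A V t (\<lambda>s. ennreal (choice_prob c) *
        (ennreal (history_likelihood n ys (wrong_value ys c) (fst s)) * \<phi> s)))"
    unfolding fake_adv_def path_sum_cmult using assms finite_V fakes
    by (intro sum.cong arg_cong2[where f = "(*)"] refl nn_integral_run_eq_path_sum) auto
  also have "\<dots> = path_sum A V t (\<lambda>s. \<Sum>c\<in>fake_choices. ennreal (choice_prob c) *
        (ennreal (history_likelihood n ys (wrong_value ys c) (fst s)) * \<phi> s))"
    by (rule path_sum_sum[OF finite_fake_choices, symmetric])
  also have "\<dots> = path_sum A V t (\<lambda>s.
      ennreal (\<Sum>c\<in>fake_choices. choice_prob c
          * history_likelihood n ys (wrong_value ys c) (fst s)) * \<phi> s)"
    by (simp add: choice_prob_nonneg history_likelihood_nonneg ennreal_mult sum_distrib_right mult.assoc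
        flip: sum_ennreal cong: sum.cong)
  finally show ?thesis by (simp add: sum_choice_prob_history_likelihood sum_joint_lik)
qed

end

section \<open>Averaging over the permutations of an instance\<close>

definition hits :: "('a \<Rightarrow> bool) \<Rightarrow> nat set \<Rightarrow> 'a list \<Rightarrow> nat" where
  "hits P D ys = card {i \<in> D. P (ys ! i)}"

lemma real_hits: "finite D \<Longrightarrow> real (hits P D ys) = (\<Sum>i\<in>D. of_bool (P (ys ! i)))"
  by (simp add: hits_def Collect_conj_eq)

lemma hits_eq_0_iff: "finite D \<Longrightarrow> hits P D ys = 0 \<longleftrightarrow> (\<forall>i\<in>D. \<not> P (ys ! i))"
  by (auto simp: hits_def)

lemma hits_mono: "finite D \<Longrightarrow> D' \<subseteq> D \<Longrightarrow> hits P D' ys \<le> hits P D ys"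
  by (auto simp: hits_def intro!: card_mono)

lemma hits_remove:
  assumes "finite D" "i \<in> D"
  shows "real (hits P (D - {i}) ys) = real (hits P D ys) - of_bool (P (ys ! i))"
  using assms by (simp add: real_hits sum.remove[of D i] del: sum_of_bool_eq)

lemma hits_Not:
  assumes "finite D"
  shows "hits (\<lambda>x. \<not> P x) D ys = card D - hits P D ys"
proof -
  have "{i \<in> D. \<not> P (ys ! i)} = D - {i \<in> D. P (ys ! i)}" by auto
  then show ?thesis using assms by (simp add: hits_def card_Diff_subset)
qed

lemma hits_lessThan_length: "hits P {..<length ys} ys = size (filter_mset P (mset ys))"
  by (simp add: hits_def length_filter_conv_card flip: mset_filter)

lemma num_ge_eq_hits: "num_ge v xs = hits (\<lambda>x. v \<le> x) {..<length xs} xs"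
  by (simp add: num_ge_def hits_def threshold_set_def)

definition swapped :: "nat \<Rightarrow> nat \<Rightarrow> 'a list \<Rightarrow> 'a list" where
  "swapped i j ys = permute_list (Transposition.transpose i j) ys"

lemma transpose_permutes_lessThan:
  "i < n \<Longrightarrow> j < n \<Longrightarrow> Transposition.transpose i j permutes {..<n}"
  by (intro permutes_swap_id) auto

lemma mset_swapped: "i < length ys \<Longrightarrow> j < length ys \<Longrightarrow> mset (swapped i j ys) = mset ys"
  by (simp add: swapped_def mset_permute_list transpose_permutes_lessThan)

lemma nth_swapped:
  "i < length ys \<Longrightarrow> j < length ys \<Longrightarrow> m < length ys \<Longrightarrow>
    swapped i j ys ! m = ys ! Transposition.transpose i j m"
  by (simp add: swapped_def permute_list_nth transpose_permutes_lessThan)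

lemma swapped_swapped: "i < length ys \<Longrightarrow> j < length ys \<Longrightarrow> swapped i j (swapped i j ys) = ys"
  using permute_list_compose[of "Transposition.transpose i j" ys "Transposition.transpose i j"]
  by (simp add: swapped_def transpose_permutes_lessThan)

lemma hits_swapped:
  assumes "D \<subseteq> {..<length ys}" "i \<in> D" "j \<in> D"
  shows "hits P D (swapped i j ys) = hits P D ys"
proof -
  have finite_D: "finite D" using assms(1) finite_subset by blast
  have "real (hits P D (swapped i j ys)) = (\<Sum>m\<in>D. of_bool (P (ys ! Transposition.transpose i j m)))"
    unfolding real_hits[OF finite_D] using assms
    by (intro sum.cong) (auto simp: subset_eq nth_swapped)
  also have "\<dots> = real (hits P D ys)"
    unfolding real_hits[OF finite_D]
    using sum.permute[OF permutes_swap_id[OF assms(2,3)], of "\<lambda>m. of_bool (P (ys ! m)) :: real"]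
    by (simp add: o_def)
  finally show ?thesis by simp
qed

locale hidden_instance = noise_model +
  fixes xs :: "real list" and A :: algorithm
  assumes length_xs: "length xs = n" and set_xs: "set xs \<subseteq> V" and queries_valid: "algorithm_on n A"
begin

definition perms :: "real list set" where
  "perms = permutations_of_multiset (mset xs)"

lemma mem_perms_iff: "ys \<in> perms \<longleftrightarrow> mset ys = mset xs"
  by (simp add: perms_def permutations_of_multiset_def)

lemma finite_perms [simp]: "finite perms"
  by (simp add: perms_def)

lemma perms_nonempty [simp]: "perms \<noteq> {}"
  by (simp add: perms_def)

lemma card_perms_pos: "0 < card perms"
  by (simp add: card_gt_0_iff)

lemma length_perms: "ys \<in> perms \<Longrightarrow> length ys = n"
  using length_xs by (auto simp: mem_perms_iff dest: mset_eq_length)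

lemma set_perms_subset: "ys \<in> perms \<Longrightarrow> set ys \<subseteq> V"
  using set_xs mset_eq_setD[of ys xs] by (simp add: mem_perms_iff)

lemma nth_perms: "ys \<in> perms \<Longrightarrow> i < n \<Longrightarrow> ys ! i \<in> V"
  using set_perms_subset[of ys] length_perms[of ys] nth_mem[of i ys] by auto

lemma swapped_in_perms: "ys \<in> perms \<Longrightarrow> i < n \<Longrightarrow> j < n \<Longrightarrow> swapped i j ys \<in> perms"
  using mset_swapped[of i ys j] length_perms[of ys] by (simp add: mem_perms_iff)

lemma sum_perms_swapped:
  assumes "i < n" "j < n"
  shows "(\<Sum>ys\<in>perms. F (swapped i j ys)) = (\<Sum>ys\<in>perms. F ys)"
  using assms
  by (intro sum.reindex_bij_witness[of _ "swapped i j" "swapped i j"])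
    (auto simp: swapped_swapped swapped_in_perms length_perms)

lemma joint_lik_swapped:
  assumes "ys \<in> perms" "G \<subseteq> {..<n}" "i \<in> G - late h" "j \<in> G - late h"
  shows "joint_lik G (swapped i j ys) h = joint_lik G ys h"
  unfolding joint_lik_def
proof (intro prod.cong refl)
  fix m assume "m \<in> {..<n}"
  then have below_length: "i < length ys" "j < length ys" "m < length ys"
    using assms by (auto simp: length_perms)
  show "(if m \<in> G then deceiver_lik (swapped i j ys ! m) (responses m h)
        else other_lik (swapped i j ys ! m) (responses m h)) =
      (if m \<in> G then deceiver_lik (ys ! m) (responses m h) else other_lik (ys ! m) (responses m h))"
  proof (cases "m = i \<or> m = j")
    case True
    then have "length (responses m h) \<le> q" "m \<in> G" using assms by (auto simp: late_def)
    then show ?thesis using deceiver_lik_short_cong by auto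
  next
    case False
    then show ?thesis
      using nth_swapped[OF below_length] by (auto simp: Transposition.transpose_def)
  qed
qed

lemma sum_joint_lik_swapped:
  assumes "G \<subseteq> {..<n}" "i \<in> G - late h" "j \<in> G - late h"
  shows "(\<Sum>ys\<in>perms. joint_lik G ys h * F (swapped i j ys)) = (\<Sum>ys\<in>perms. joint_lik G ys h * F ys)"
proof -
  have "i < n" "j < n" using assms by auto
  then have "(\<Sum>ys\<in>perms. joint_lik G ys h * F ys) =
      (\<Sum>ys\<in>perms. joint_lik G (swapped i j ys) h * F (swapped i j ys))"
    by (rule sum_perms_swapped[symmetric])
  also have "\<dots> = (\<Sum>ys\<in>perms. joint_lik G ys h * F (swapped i j ys))"
    using assms by (intro sum.cong) (auto simp: joint_lik_swapped)
  finally show ?thesis ..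
qed

text \<open>
  The joint likelihood of the history \<open>h\<close> and the hidden data, integrated against \<open>\<phi>\<close>; up to the
  factor \<open>posterior h (\<lambda>_ _. 1)\<close> it is the posterior expectation of \<open>\<phi>\<close>.
\<close>

definition posterior :: "history \<Rightarrow> (real list \<Rightarrow> nat set \<Rightarrow> real) \<Rightarrow> real" where
  "posterior h \<phi> = (\<Sum>ys\<in>perms. \<Sum>G\<in>Pow {..<n}. joint_lik G ys h * \<phi> ys G) / card perms"

lemma posterior_mono:
  assumes "\<And>ys G. ys \<in> perms \<Longrightarrow> G \<subseteq> {..<n} \<Longrightarrow> \<phi> ys G \<le> \<psi> ys G"
  shows "posterior h \<phi> \<le> posterior h \<psi>"
  unfolding posterior_def using assms
  by (intro divide_right_mono sum_mono mult_left_mono joint_lik_nonneg) auto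

lemma posterior_nonneg:
  assumes "\<And>ys G. ys \<in> perms \<Longrightarrow> G \<subseteq> {..<n} \<Longrightarrow> 0 \<le> \<phi> ys G"
  shows "0 \<le> posterior h \<phi>"
  unfolding posterior_def using assms
  by (intro divide_nonneg_nonneg sum_nonneg mult_nonneg_nonneg joint_lik_nonneg) auto

lemma posterior_add: "posterior h (\<lambda>ys G. \<phi> ys G + \<psi> ys G) = posterior h \<phi> + posterior h \<psi>"
  by (simp add: posterior_def distrib_left sum.distrib add_divide_distrib)

lemma posterior_cmult: "posterior h (\<lambda>ys G. c * \<phi> ys G) = c * posterior h \<phi>"
  by (simp add: posterior_def sum_distrib_left mult_ac)

lemma posterior_swap_sums:
  "posterior h \<phi> = (\<Sum>G\<in>Pow {..<n}. \<Sum>ys\<in>perms. joint_lik G ys h * \<phi> ys G) / card perms"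
  unfolding posterior_def by (subst sum.swap) (rule refl)

lemma posterior_le_fibrewise:
  assumes "\<And>G. G \<subseteq> {..<n} \<Longrightarrow>
    (\<Sum>ys\<in>perms. joint_lik G ys h * \<phi> ys G) \<le> (\<Sum>ys\<in>perms. joint_lik G ys h * \<psi> ys G)"
  shows "posterior h \<phi> \<le> posterior h \<psi>"
  unfolding posterior_swap_sums using assms
  by (intro divide_right_mono sum_mono[of "Pow {..<n}"]) auto

lemma sum_posterior_snoc:
  assumes "i < n"
  shows "(\<Sum>y\<in>V. posterior (h @ [(i, y)]) \<phi>) = posterior h \<phi>"
proof -
  have "(\<Sum>y\<in>V. \<Sum>ys\<in>perms. \<Sum>G\<in>Pow {..<n}. joint_lik G ys (h @ [(i, y)]) * \<phi> ys G) =
      (\<Sum>ys\<in>perms. \<Sum>G\<in>Pow {..<n}. \<Sum>y\<in>V. joint_lik G ys (h @ [(i, y)]) * \<phi> ys G)"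
    by (subst sum.swap, subst sum.swap) (rule refl)
  also have "\<dots> = (\<Sum>ys\<in>perms. \<Sum>G\<in>Pow {..<n}. joint_lik G ys h * \<phi> ys G)"
    by (intro sum.cong refl) (simp add: sum_joint_lik_snoc assms nth_perms flip: sum_distrib_right)
  finally show ?thesis by (simp add: posterior_def flip: sum_divide_distrib)
qed

lemma posterior_Nil_le:
  assumes "\<And>ys. ys \<in> perms \<Longrightarrow> (\<Sum>G\<in>Pow {..<n}. deceiver_set_prob G * \<phi> ys G) \<le> c"
  shows "posterior [] \<phi> \<le> c"
proof -
  have "(\<Sum>ys\<in>perms. \<Sum>G\<in>Pow {..<n}. deceiver_set_prob G * \<phi> ys G) \<le> (\<Sum>ys\<in>perms. c)"
    by (intro sum_mono assms)
  then show ?thesis using card_perms_pos by (simp add: posterior_def divide_le_eq mult.commute)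
qed

definition hidden_expectation ::
    "nat \<Rightarrow> (real list \<Rightarrow> nat set \<Rightarrow> run_state \<Rightarrow> real) \<Rightarrow> ennreal" where
  "hidden_expectation t \<phi> = path_sum A V t (\<lambda>s. ennreal (posterior (fst s) (\<lambda>ys G. \<phi> ys G s)))"

abbreviation hidden_prob ::
    "nat \<Rightarrow> (real list \<Rightarrow> nat set \<Rightarrow> run_state \<Rightarrow> bool) \<Rightarrow> ennreal" where
  "hidden_prob t E \<equiv> hidden_expectation t (\<lambda>ys G s. of_bool (E ys G s))"

lemma hidden_expectation_mono:
  assumes "\<And>ys G s. ys \<in> perms \<Longrightarrow> G \<subseteq> {..<n} \<Longrightarrow> \<phi> ys G s \<le> \<psi> ys G s"
  shows "hidden_expectation t \<phi> \<le> hidden_expectation t \<psi>"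
  unfolding hidden_expectation_def using assms
  by (intro path_sum_mono ennreal_leI posterior_mono)

lemma hidden_expectation_add_le:
  assumes "hidden_expectation t \<phi> \<le> ennreal a" "hidden_expectation t \<psi> \<le> ennreal b"
    and "0 \<le> a" "0 \<le> b"
  shows "hidden_expectation t (\<lambda>ys G s. \<phi> ys G s + \<psi> ys G s) \<le> ennreal (a + b)"
proof -
  have "hidden_expectation t (\<lambda>ys G s. \<phi> ys G s + \<psi> ys G s) \<le>
      path_sum A V t (\<lambda>s. ennreal (posterior (fst s) (\<lambda>ys G. \<phi> ys G s)) +
        ennreal (posterior (fst s) (\<lambda>ys G. \<psi> ys G s)))"
    unfolding hidden_expectation_def posterior_add
    by (intro path_sum_mono) (auto simp: ennreal_plus_if intro: ennreal_leI)
  also have "\<dots> \<le> ennreal a + ennreal b"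
    using add_mono[OF assms(1,2)] by (simp add: path_sum_add hidden_expectation_def)
  finally show ?thesis using assms(3,4) by simp
qed

lemma hidden_expectation_late_supermartingale:
  assumes nonneg: "\<And>ys G L. ys \<in> perms \<Longrightarrow> G \<subseteq> {..<n} \<Longrightarrow> 0 \<le> \<phi> ys G L"
    and insert_late_le: "\<And>h i. i < n \<Longrightarrow> i \<notin> late h \<Longrightarrow>
      posterior h (\<lambda>ys G. \<phi> ys G (insert i (late h))) \<le> posterior h (\<lambda>ys G. \<phi> ys G (late h))"
  shows "hidden_expectation t (\<lambda>ys G s. \<phi> ys G (late (fst s)))
      \<le> ennreal (posterior [] (\<lambda>ys G. \<phi> ys G {}))"
proof -
  have "path_sum A V t (\<lambda>s. ennreal (posterior (fst s) (\<lambda>ys G. \<phi> ys G (late (fst s)))))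
      \<le> ennreal (posterior [] (\<lambda>ys G. \<phi> ys G (late [])))"
  proof (rule path_sum_supermartingale[OF queries_valid])
    fix h i assume i_less: "i < n"
    define L where "L = (if length (responses i h) = q then insert i (late h) else late h)"
    have "(\<Sum>y\<in>V. posterior (h @ [(i, y)]) (\<lambda>ys G. \<phi> ys G (late (h @ [(i, y)])))) =
        posterior h (\<lambda>ys G. \<phi> ys G L)"
      using i_less by (simp add: late_snoc L_def[symmetric] sum_posterior_snoc)
    also have "\<dots> \<le> posterior h (\<lambda>ys G. \<phi> ys G (late h))"
      using insert_late_le[OF i_less, of h] by (auto simp: L_def late_def)
    finally show "(\<Sum>y\<in>V. posterior (h @ [(i, y)]) (\<lambda>ys G. \<phi> ys G (late (h @ [(i, y)]))))
        \<le> posterior h (\<lambda>ys G. \<phi> ys G (late h))" .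
  qed (simp add: posterior_nonneg nonneg)
  then show ?thesis by (simp add: hidden_expectation_def)
qed

lemma hidden_expectation_static_le:
  assumes "\<And>ys G. ys \<in> perms \<Longrightarrow> G \<subseteq> {..<n} \<Longrightarrow> 0 \<le> \<phi> ys G"
    and "\<And>ys. ys \<in> perms \<Longrightarrow> (\<Sum>G\<in>Pow {..<n}. deceiver_set_prob G * \<phi> ys G) \<le> c"
  shows "hidden_expectation t (\<lambda>ys G _. \<phi> ys G) \<le> ennreal c"
  using hidden_expectation_late_supermartingale[of "\<lambda>ys G _. \<phi> ys G" t] posterior_Nil_le[of \<phi> c] assms
  by (auto intro: order_trans[OF _ ennreal_leI])

lemma hidden_prob_no_hits_le:
  "hidden_prob t (\<lambda>ys G _. hits P G ys = 0) \<le> ennreal ((1 - deceiver_prob) ^ hits P {..<n} xs)"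
proof (rule hidden_expectation_static_le)
  fix ys assume perm: "ys \<in> perms"
  let ?H = "{i \<in> {..<n}. P (ys ! i)}"
  have "(\<Sum>G\<in>Pow {..<n}. deceiver_set_prob G * of_bool (hits P G ys = 0)) =
      (\<Sum>G\<in>Pow {..<n}. deceiver_set_prob G * of_bool (G \<inter> ?H = {}))"
    by (intro sum.cong refl arg_cong2[where f = "(*)"] arg_cong[where f = of_bool])
      (auto simp: hits_eq_0_iff finite_subset)
  also have "\<dots> = (1 - deceiver_prob) ^ hits P {..<n} ys"
    unfolding hits_def by (rule sum_deceiver_set_prob_disjoint) auto
  also have "hits P {..<n} ys = hits P {..<n} xs"
    using perm hits_lessThan_length[of P ys] hits_lessThan_length[of P xs] length_xs length_perms[OF perm]
    by (simp add: mem_perms_iff)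
  finally show "(\<Sum>G\<in>Pow {..<n}. deceiver_set_prob G * of_bool (hits P G ys = 0))
      \<le> (1 - deceiver_prob) ^ hits P {..<n} xs" by simp
qed simp

lemma hidden_prob_eq_average_run:
  "hidden_prob t (\<lambda>ys _ s. E ys s) = ennreal (1 / real (card perms)) *
    (\<Sum>ys\<in>perms. \<Sum>c\<in>fake_choices.
      ennreal (choice_prob c) * emeasure (run A (fake_adv ys c) ys t) {s. E ys s})"
proof -
  have posterior_eq: "ennreal (posterior h (\<lambda>ys _. of_bool (Q ys))) =
      ennreal (1 / real (card perms)) *
        (\<Sum>ys\<in>perms. ennreal (\<Sum>G\<in>Pow {..<n}. joint_lik G ys h) * of_bool (Q ys))"
    for h Q
  proof -
    have "(\<Sum>ys\<in>perms. ennreal (\<Sum>G\<in>Pow {..<n}. joint_lik G ys h) * of_bool (Q ys)) =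
        (\<Sum>ys\<in>perms. ennreal (\<Sum>G\<in>Pow {..<n}. joint_lik G ys h * of_bool (Q ys)))"
      by (intro sum.cong) auto
    then show ?thesis
      by (simp add: posterior_def sum_nonneg joint_lik_nonneg flip: ennreal_mult)
  qed
  have "hidden_prob t (\<lambda>ys _ s. E ys s) = ennreal (1 / real (card perms)) *
      (\<Sum>ys\<in>perms. path_sum A V t (\<lambda>s. ennreal (\<Sum>G\<in>Pow {..<n}. joint_lik G ys (fst s))
          * of_bool (E ys s)))"
    by (simp only: hidden_expectation_def posterior_eq path_sum_cmult path_sum_sum[OF finite_perms])
  also have "\<dots> = ennreal (1 / real (card perms))
      * (\<Sum>ys\<in>perms. \<Sum>c\<in>fake_choices. ennreal (choice_prob c) *
          (\<integral>\<^sup>+ s. of_bool (E ys s) \<partial>run A (fake_adv ys c) ys t))"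
    by (simp add: sum_choice_prob_nn_integral_run[OF queries_valid] nth_perms)
  finally show ?thesis
    by (simp add: indicator_def flip: nn_integral_indicator)
qed

lemma average_run_const:
  "ennreal (1 / real (card perms)) * (\<Sum>ys\<in>perms. \<Sum>c\<in>fake_choices. ennreal (choice_prob c) * x) = x"
proof -
  have "(\<Sum>c\<in>fake_choices. ennreal (choice_prob c) * x) = x"
    by (simp add: choice_prob_nonneg sum_choice_prob flip: sum_distrib_right)
  moreover have "ennreal (1 / real (card perms)) * of_nat (card perms) = 1"
    using card_perms_pos by (simp add: ennreal_of_nat_eq_real_of_nat flip: ennreal_mult)
  ultimately show ?thesis by (simp flip: mult.assoc)
qed

lemma hidden_prob_ge_of_run:
  assumes "\<And>ys c. ys \<in> perms \<Longrightarrow> c \<in> fake_choices \<Longrightarrow>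
    x \<le> emeasure (run A (fake_adv ys c) ys t) {s. E ys s}"
  shows "x \<le> hidden_prob t (\<lambda>ys _ s. E ys s)"
proof -
  have "x = ennreal (1 / real (card perms)) *
      (\<Sum>ys\<in>perms. \<Sum>c\<in>fake_choices. ennreal (choice_prob c) * x)"
    by (rule average_run_const[symmetric])
  also have "\<dots> \<le> hidden_prob t (\<lambda>ys _ s. E ys s)"
    unfolding hidden_prob_eq_average_run by (intro mult_left_mono sum_mono assms; simp)
  finally show ?thesis .
qed

lemma hidden_prob_le_of_run:
  assumes "\<And>ys c. ys \<in> perms \<Longrightarrow> c \<in> fake_choices \<Longrightarrow>
    emeasure (run A (fake_adv ys c) ys t) {s. E ys s} \<le> x"
  shows "hidden_prob t (\<lambda>ys _ s. E ys s) \<le> x"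
proof -
  have "hidden_prob t (\<lambda>ys _ s. E ys s) \<le> ennreal (1 / real (card perms)) *
      (\<Sum>ys\<in>perms. \<Sum>c\<in>fake_choices. ennreal (choice_prob c) * x)"
    unfolding hidden_prob_eq_average_run by (intro mult_left_mono sum_mono assms; simp)
  then show ?thesis by (simp only: average_run_const)
qed

end

subsection \<open>Exchangeability of the deceivers that are not late\<close>

lemma threshold_set_swapped_neq:
  assumes "i < length ys" "j < length ys" "i \<in> threshold_set v ys" "j \<notin> threshold_set v ys"
  shows "threshold_set v (swapped i j ys) \<noteq> threshold_set v ys"
proof -
  have "j \<in> threshold_set v (swapped i j ys)"
    using assms nth_swapped[of i ys j j] mset_eq_length[OF mset_swapped[of i ys j]]
    by (simp add: threshold_set_def)
  then show ?thesis using assms(4) by blast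
qed

text \<open>
  With \<open>L\<close> the late locations this is a martingale: the deceiver about to become late is
  exchangeable with all deceivers that are not late.
\<close>

definition survival :: "('a \<Rightarrow> bool) \<Rightarrow> 'a list \<Rightarrow> nat set \<Rightarrow> nat set \<Rightarrow> real" where
  "survival P ys G L = real (hits P (G - L) ys) / real (hits P G ys) / real (card (G - L))"

text \<open>
  Stopped when more than \<open>m\<close> deceivers are late; equal to \<open>1\<close> if all deceivers with property \<open>P\<close>
  become late before that.
\<close>

definition depletion :: "('a \<Rightarrow> bool) \<Rightarrow> real \<Rightarrow> 'a list \<Rightarrow> nat set \<Rightarrow> nat set \<Rightarrow> real" where
  "depletion P m ys G L = of_bool (real (card (G \<inter> L)) \<le> m) *
    (of_bool (0 < hits P G ys) - (real (card G) - m) * survival P ys G L)"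

lemma depletion_nonneg:
  assumes "finite G" "m < real (card G)"
  shows "0 \<le> depletion P m ys G L"
proof (cases "real (card (G \<inter> L)) \<le> m \<and> 0 < hits P G ys")
  case True
  have "real (card (G - L)) = real (card G) - real (card (G \<inter> L))"
    using card_Diff_subset_Int[of G L] card_mono[of G "G \<inter> L"] assms(1) by (simp add: of_nat_diff)
  then have survivors: "real (card G) - m \<le> real (card (G - L))" "0 < real (card (G - L))"
    using True assms(2) by linarith+
  have "real (hits P (G - L) ys) / real (hits P G ys) \<le> 1"
    using True hits_mono[OF assms(1), of "G - L" P ys] by simp
  then have "(real (card G) - m) * (real (hits P (G - L) ys) / real (hits P G ys))
      \<le> real (card (G - L)) * 1"
    using survivors assms(2) by (intro mult_mono) auto
  then have "(real (card G) - m)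
      * (real (hits P (G - L) ys) / real (hits P G ys)) / real (card (G - L)) \<le> 1"
    using survivors(2) by (simp only: divide_le_eq_1_pos mult_1_right)
  then have "(real (card G) - m) * survival P ys G L \<le> 1"
    by (simp add: survival_def)
  then show ?thesis using True by (simp add: depletion_def)
qed (auto simp: depletion_def survival_def)

lemma depletion_no_survivor:
  assumes "real (card (G \<inter> L)) \<le> m" "0 < hits P G ys" "hits P (G - L) ys = 0"
  shows "depletion P m ys G L = 1"
  using assms by (simp add: depletion_def survival_def)

lemma depletion_empty_le:
  assumes "0 \<le> m" "m < real (card G)"
  shows "depletion P m ys G {} \<le> m / real (card G)"
  using assms by (auto simp: depletion_def survival_def field_simps)

context hidden_instance
begin

lemma sum_joint_lik_correct_le:
  fixes v :: real and h :: history
  assumes G_subset: "G \<subseteq> {..<n}"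
  defines "D \<equiv> G - late h"
  shows "2 * (\<Sum>ys\<in>perms. joint_lik G ys h * of_bool (S = threshold_set v ys)) \<le>
    (\<Sum>ys\<in>perms. joint_lik G ys h *
      (1 + of_bool (hits (\<lambda>x. v \<le> x) D ys = 0 \<or> hits (\<lambda>x. \<not> v \<le> x) D ys = 0)))"
proof (cases "D \<inter> S = {} \<or> D - S = {}")
  case True
  have "2 * of_bool (S = threshold_set v ys) \<le>
      (1 + of_bool (hits (\<lambda>x. v \<le> x) D ys = 0 \<or> hits (\<lambda>x. \<not> v \<le> x) D ys = 0) :: real)"
    if "ys \<in> perms" for ys
  proof (cases "S = threshold_set v ys")
    case threshold: True
    have "(\<forall>i\<in>D. \<not> v \<le> ys ! i) \<or> (\<forall>i\<in>D. v \<le> ys ! i)"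
      using True G_subset length_perms[OF that] unfolding D_def threshold threshold_set_def
      by fastforce
    moreover have "finite D" using G_subset by (auto simp: D_def intro: finite_subset)
    ultimately show ?thesis by (simp add: threshold hits_eq_0_iff)
  qed auto
  then show ?thesis
    unfolding sum_distrib_left mult.left_commute[of 2]
    by (intro sum_mono mult_left_mono joint_lik_nonneg) auto
next
  case False
  then obtain i j where in_D: "i \<in> D" "j \<in> D" and "i \<in> S" "j \<notin> S" by auto
  then have exclusive: "\<not> (S = threshold_set v ys \<and> S = threshold_set v (swapped i j ys))"
    if "ys \<in> perms" for ys
    using threshold_set_swapped_neq[of i ys j v] G_subset length_perms[OF that]
    unfolding D_def by blast
  have "2 * (\<Sum>ys\<in>perms. joint_lik G ys h * of_bool (S = threshold_set v ys)) =
      (\<Sum>ys\<in>perms. joint_lik G ys h *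
        (of_bool (S = threshold_set v ys) + of_bool (S = threshold_set v (swapped i j ys))))"
    using sum_joint_lik_swapped[OF G_subset, of i h j "\<lambda>ys. of_bool (S = threshold_set v ys)"] in_D
    by (simp add: D_def distrib_left sum.distrib)
  also have "\<dots> \<le> (\<Sum>ys\<in>perms. joint_lik G ys h *
      (1 + of_bool (hits (\<lambda>x. v \<le> x) D ys = 0 \<or> hits (\<lambda>x. \<not> v \<le> x) D ys = 0)))"
    using exclusive by (intro sum_mono mult_left_mono joint_lik_nonneg) auto
  finally show ?thesis .
qed

lemma hidden_prob_correct_le:
  "2 * hidden_prob t (\<lambda>ys _ s. s \<in> correct_states v ys) \<le>
    hidden_expectation t (\<lambda>ys G s. 1 + of_bool (
      hits (\<lambda>x. v \<le> x) (G - late (fst s)) ys = 0 \<or> hits (\<lambda>x. \<not> v \<le> x) (G - late (fst s)) ys = 0))"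
proof -
  have "2 * posterior (fst s) (\<lambda>ys _. of_bool (s \<in> correct_states v ys)) \<le>
      posterior (fst s) (\<lambda>ys G. 1 + of_bool (
        hits (\<lambda>x. v \<le> x) (G - late (fst s)) ys = 0 \<or> hits (\<lambda>x. \<not> v \<le> x) (G - late (fst s)) ys = 0))"
    for s :: run_state
  proof (cases "snd s")
    case None
    then show ?thesis by (simp add: posterior_nonneg posterior_def[of _ "\<lambda>_ _. 0"] correct_states_def)
  next
    case (Some S)
    have "(\<Sum>ys\<in>perms. joint_lik G ys (fst s) * (2 * \<phi> ys))
        = 2 * (\<Sum>ys\<in>perms. joint_lik G ys (fst s) * \<phi> ys)"
      for G \<phi> by (simp only: sum_distrib_left mult.left_commute)
    then show ?thesis
      unfolding posterior_cmult[symmetric] correct_states_def mem_Collect_eq Some option.inject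
      using sum_joint_lik_correct_le[of _ "fst s" S v]
      by (intro posterior_le_fibrewise) (simp only:)
  qed
  then show ?thesis
    unfolding hidden_expectation_def path_sum_cmult[symmetric]
    by (intro path_sum_mono)
      (simp add: ennreal_leI posterior_nonneg flip: ennreal_mult ennreal_numeral)
qed

lemma sum_joint_lik_survivor:
  assumes G_subset: "G \<subseteq> {..<n}" and i_survives: "i \<in> G - late h"
  shows "(\<Sum>ys\<in>perms. joint_lik G ys h * (of_bool (P (ys ! i)) / real (hits P G ys))) =
    (\<Sum>ys\<in>perms. joint_lik G ys h * survival P ys G (late h))"
proof -
  let ?D = "G - late h"
  let ?share = "\<lambda>j. \<Sum>ys\<in>perms. joint_lik G ys h * (of_bool (P (ys ! j)) / real (hits P G ys))"
  have finite_D: "finite ?D" using G_subset by (auto intro: finite_subset)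
  have "?share j = ?share i" if "j \<in> ?D" for j
  proof -
    have "?share j = (\<Sum>ys\<in>perms. joint_lik G ys h *
        (of_bool (P (swapped i j ys ! i)) / real (hits P G (swapped i j ys))))"
      using i_survives that G_subset
      by (intro sum.cong refl) (auto simp: hits_swapped nth_swapped length_perms subset_eq)
    then show ?thesis
      using sum_joint_lik_swapped[OF G_subset i_survives that,
          of "\<lambda>ys. of_bool (P (ys ! i)) / real (hits P G ys)"]
      by simp
  qed
  then have "real (card ?D) * ?share i = (\<Sum>j\<in>?D. ?share j)"
    by simp
  also have "\<dots> = (\<Sum>ys\<in>perms. joint_lik G ys h * (real (hits P ?D ys) / real (hits P G ys)))"
    by (subst sum.swap)
      (simp add: real_hits[OF finite_D] sum_distrib_left[symmetric] sum_divide_distrib[symmetric]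
        del: sum_of_bool_eq)
  finally have "?share i =
      (\<Sum>ys\<in>perms. joint_lik G ys h * (real (hits P ?D ys) / real (hits P G ys))) / real (card ?D)"
    using i_survives finite_D
    by (subst nonzero_eq_divide_eq) (auto simp only: mult.commute of_nat_eq_0_iff card_0_eq)
  then show ?thesis by (simp add: survival_def sum_divide_distrib)
qed

lemma sum_joint_lik_survival_insert:
  assumes G_subset: "G \<subseteq> {..<n}" and i_survives: "i \<in> G - late h" and "1 < card (G - late h)"
  shows "(\<Sum>ys\<in>perms. joint_lik G ys h * survival P ys G (insert i (late h))) =
    (\<Sum>ys\<in>perms. joint_lik G ys h * survival P ys G (late h))"
proof -
  let ?D = "G - late h"
  define N where "N = real (card ?D)"
  have finite_D: "finite ?D" using G_subset by (auto intro: finite_subset)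
  have N_gt_1: "1 < N" using assms(3) by (simp add: N_def)
  have remove: "G - insert i (late h) = ?D - {i}" by auto
  have card_remove: "real (card (?D - {i})) = N - 1"
    using i_survives assms(3) finite_D by (simp add: N_def card_Diff_singleton of_nat_diff)
  have survival_insert: "survival P ys G (insert i (late h)) =
      (N * survival P ys G (late h) - of_bool (P (ys ! i)) / real (hits P G ys)) / (N - 1)" for ys
    using N_gt_1 hits_remove[OF finite_D i_survives, of P ys]
    by (simp add: survival_def remove card_remove diff_divide_distrib flip: N_def)
  have "(\<Sum>ys\<in>perms. joint_lik G ys h * survival P ys G (insert i (late h))) =
      (N * (\<Sum>ys\<in>perms. joint_lik G ys h * survival P ys G (late h))
        - (\<Sum>ys\<in>perms. joint_lik G ys h * (of_bool (P (ys ! i)) / real (hits P G ys)))) / (N - 1)"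
    unfolding survival_insert
    by (simp add: sum_subtractf sum_distrib_left right_diff_distrib mult_ac
        flip: sum_divide_distrib)
  also have "\<dots> = (\<Sum>ys\<in>perms. joint_lik G ys h * survival P ys G (late h))"
    using N_gt_1 unfolding sum_joint_lik_survivor[OF G_subset i_survives] by (simp add: field_simps)
  finally show ?thesis .
qed

lemma sum_joint_lik_depletion_insert_le:
  assumes G_subset: "G \<subseteq> {..<n}" and i_not_late: "i \<in> {..<n} - late h"
    and m_less: "m < real (card G)"
  shows "(\<Sum>ys\<in>perms. joint_lik G ys h * depletion P m ys G (insert i (late h))) \<le>
    (\<Sum>ys\<in>perms. joint_lik G ys h * depletion P m ys G (late h))"
proof (cases "i \<in> G")
  case False
  then have "G \<inter> insert i (late h) = G \<inter> late h" "G - insert i (late h) = G - late h" by auto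
  then show ?thesis by (simp add: depletion_def survival_def)
next
  case True
  then have i_survives: "i \<in> G - late h" using i_not_late by simp
  have finite_G: "finite G" using G_subset finite_subset by blast
  have card_insert: "card (G \<inter> insert i (late h)) = card (G \<inter> late h) + 1"
    using i_survives finite_G by simp
  show ?thesis
  proof (cases "real (card (G \<inter> late h)) + 1 \<le> m")
    case False
    then have "depletion P m ys G (insert i (late h)) = 0" for ys
      by (simp add: depletion_def card_insert)
    then show ?thesis
      by (simp add: sum_nonneg joint_lik_nonneg depletion_nonneg[OF finite_G m_less])
  next
    case few: True
    have "card (G - late h) = card G - card (G \<inter> late h)"
      using card_Diff_subset_Int[of G "late h"] by simp
    then have "1 < card (G - late h)" using few m_less by linarith
    then have "(\<Sum>ys\<in>perms. joint_lik G ys h * survival P ys G (insert i (late h))) =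
        (\<Sum>ys\<in>perms. joint_lik G ys h * survival P ys G (late h))"
      by (rule sum_joint_lik_survival_insert[OF G_subset i_survives])
    moreover have "(\<Sum>ys\<in>perms. joint_lik G ys h * depletion P m ys G L) =
        (\<Sum>ys\<in>perms. joint_lik G ys h * of_bool (0 < hits P G ys))
        - (real (card G) - m) * (\<Sum>ys\<in>perms. joint_lik G ys h * survival P ys G L)"
      if "real (card (G \<inter> L)) \<le> m" for L
      using that
      by (simp only: depletion_def right_diff_distrib sum_subtractf sum_distrib_left mult.left_commute) simp
    ultimately show ?thesis using few by (simp add: card_insert)
  qed
qed

lemma hidden_prob_no_survivor_le:
  assumes m_bounds: "0 \<le> m" "m < g"
  shows "hidden_prob t (\<lambda>ys G s. typical g m G (fst s) \<and>
      0 < hits P G ys \<and> hits P (G - late (fst s)) ys = 0) \<le> ennreal (m / g)"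
proof -
  define \<phi> where "\<phi> ys G L = of_bool (g \<le> real (card G)) * depletion P m ys G L" for ys G L
  have nonneg: "0 \<le> \<phi> ys G L" if "G \<subseteq> {..<n}" for ys G L
    using depletion_nonneg[OF finite_subset[OF that], of m] m_bounds by (auto simp: \<phi>_def)
  have "hidden_prob t (\<lambda>ys G s. typical g m G (fst s) \<and>
      0 < hits P G ys \<and> hits P (G - late (fst s)) ys = 0)
    \<le> hidden_expectation t (\<lambda>ys G s. \<phi> ys G (late (fst s)))"
    using nonneg
    by (intro hidden_expectation_mono)
      (auto simp: of_bool_def \<phi>_def typical_def depletion_no_survivor)
  also have "\<dots> \<le> ennreal (posterior [] (\<lambda>ys G. \<phi> ys G {}))"
  proof (rule hidden_expectation_late_supermartingale)
    show "posterior h (\<lambda>ys G. \<phi> ys G (insert i (late h))) \<le> posterior h (\<lambda>ys G. \<phi> ys G (late h))"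
      if "i < n" "i \<notin> late h" for h i
      using sum_joint_lik_depletion_insert_le[of _ i h m P] that m_bounds
      by (intro posterior_le_fibrewise) (auto simp: \<phi>_def)
  qed (rule nonneg)
  also have "\<dots> \<le> ennreal (m / g)"
  proof (intro ennreal_leI posterior_Nil_le)
    have "\<phi> ys G {} \<le> m / g" for ys G
    proof (cases "g \<le> real (card G)")
      case True
      have "depletion P m ys G {} \<le> m / real (card G)"
        using True m_bounds by (intro depletion_empty_le) auto
      also have "\<dots> \<le> m / g" using True m_bounds by (intro divide_left_mono) auto
      finally show ?thesis using True by (simp add: \<phi>_def)
    qed (use m_bounds in \<open>auto simp: \<phi>_def\<close>)
    then have "(\<Sum>G\<in>Pow {..<n}. deceiver_set_prob G * \<phi> ys G {}) \<le>
        (\<Sum>G\<in>Pow {..<n}. deceiver_set_prob G * (m / g))" for ys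
      by (intro sum_mono mult_left_mono deceiver_set_prob_nonneg)
    then show "(\<Sum>G\<in>Pow {..<n}. deceiver_set_prob G * \<phi> ys G {}) \<le> m / g" for ys
      by (simp only: sum_distrib_right[symmetric] sum_deceiver_set_prob mult_1)
  qed
  finally show ?thesis .
qed

end

subsection \<open>Comparison with independent values\<close>

lemma sum_lists_prod_nth:
  fixes F :: "nat \<Rightarrow> 'a \<Rightarrow> 'b :: comm_semiring_1"
  shows "(\<Sum>ys | set ys \<subseteq> V \<and> length ys = n. \<Prod>i<n. F i (ys ! i)) = (\<Prod>i<n. \<Sum>x\<in>V. F i x)"
proof (induction n arbitrary: F)
  case 0
  have "{ys. set ys \<subseteq> V \<and> length ys = 0} = {[]}" by auto
  then show ?case by simp
next
  case (Suc n)
  let ?L = "{ys. set ys \<subseteq> V \<and> length ys = n}"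
  have "(\<Sum>ys | set ys \<subseteq> V \<and> length ys = Suc n. \<Prod>i<Suc n. F i (ys ! i)) =
      (\<Sum>(ys, x)\<in>?L \<times> V. F 0 x * (\<Prod>i<n. F (Suc i) (ys ! i)))"
    unfolding lists_length_Suc_eq
    by (subst sum.reindex)
      (auto simp: inj_on_def prod.lessThan_Suc_shift split_beta' simp del: prod.lessThan_Suc)
  also have "\<dots> = (\<Sum>x\<in>V. F 0 x) * (\<Sum>ys\<in>?L. \<Prod>i<n. F (Suc i) (ys ! i))"
    unfolding sum_product by (subst sum.swap) (simp add: sum.cartesian_product)
  finally show ?case
    using Suc.IH[of "\<lambda>i. F (Suc i)"] by (simp add: prod.lessThan_Suc_shift del: prod.lessThan_Suc)
qed

context noise_model
begin

definition avg_total_lik :: "real list \<Rightarrow> real" where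
  "avg_total_lik r = (\<Sum>x\<in>V. \<mu> x * total_lik x r)"

definition avg_deceiver_lik :: "real list \<Rightarrow> real" where
  "avg_deceiver_lik r = (\<Sum>x\<in>V. \<mu> x * deceiver_lik x r)"

definition deceiver_ratio :: real where
  "deceiver_ratio = deceiver_prob / (1 - \<kappa>)"

lemma deceiver_ratio_nonneg: "0 \<le> deceiver_ratio"
  using deceiver_prob_nonneg \<kappa>_le_1 by (simp add: deceiver_ratio_def)

lemma avg_deceiver_lik_nonneg: "0 \<le> avg_deceiver_lik r"
  by (simp add: avg_deceiver_lik_def sum_nonneg \<mu>_nonneg deceiver_lik_nonneg)

lemma avg_total_lik_nonneg: "0 \<le> avg_total_lik r"
  unfolding avg_total_lik_def
  by (intro sum_nonneg mult_nonneg_nonneg \<mu>_nonneg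
      order_trans[OF deceiver_lik_nonneg deceiver_lik_le_total_lik])

lemma sum_avg_total_lik_snoc: "(\<Sum>y\<in>V. avg_total_lik (r @ [y])) = avg_total_lik r"
  unfolding avg_total_lik_def
  by (subst sum.swap) (simp add: sum_total_lik_snoc flip: sum_distrib_left)

lemma sum_avg_deceiver_lik_snoc: "(\<Sum>y\<in>V. avg_deceiver_lik (r @ [y])) = avg_deceiver_lik r"
  unfolding avg_deceiver_lik_def
  by (subst sum.swap) (simp add: sum_deceiver_lik_snoc flip: sum_distrib_left)

text \<open>
  A deceiver with fake value \<open>f\<close> looks like an honest location with true value \<open>f\<close>, and both values
  have the same distribution.
\<close>

lemma avg_deceiver_lik_le:
  assumes short: "length r \<le> q" and "\<kappa> < 1"
  shows "avg_deceiver_lik r \<le> deceiver_ratio * avg_total_lik r"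
proof -
  define agreement where "agreement = (\<Sum>f\<in>V. \<mu> f * of_bool (\<forall>y\<in>set r. y = f))"
  have "deceiver_lik x r = deceiver_prob * agreement" for x
    using short
    by (simp add: deceiver_lik_def deceit_lik_def deceiver_prob_def agreement_def sum_distrib_left mult_ac)
  then have "avg_deceiver_lik r = deceiver_prob * agreement"
    by (simp add: avg_deceiver_lik_def sum_\<mu> flip: sum_distrib_right)
  also have "\<dots> = deceiver_ratio * ((1 - \<kappa>) * agreement)"
    using assms(2) by (simp add: deceiver_ratio_def)
  also have "(1 - \<kappa>) * agreement \<le> avg_total_lik r"
    unfolding agreement_def avg_total_lik_def sum_distrib_left
  proof (rule sum_mono)
    fix x assume "x \<in> V"
    have "(1 - \<kappa>) * of_bool (\<forall>y\<in>set r. y = x) \<le> total_lik x r"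
      unfolding total_lik_def likelihood_honest[symmetric]
      using \<kappa>_nonneg by (simp add: sum_nonneg \<mu>_nonneg likelihood_nonneg)
    then have "\<mu> x * ((1 - \<kappa>) * of_bool (\<forall>y\<in>set r. y = x)) \<le> \<mu> x * total_lik x r"
      using \<mu>_nonneg[OF \<open>x \<in> V\<close>] by (rule mult_left_mono)
    then show "(1 - \<kappa>) * (\<mu> x * of_bool (\<forall>y\<in>set r. y = x)) \<le> \<mu> x * total_lik x r"
      by (simp add: mult_ac)
  qed
  finally show ?thesis using deceiver_ratio_nonneg by (simp add: mult_left_mono)
qed

text \<open>
  Exponential tilting: under independent values, a late location is weighted by \<open>2\<close> if it is a
  deceiver and normalised by \<open>1 + deceiver_ratio\<close>.
\<close>

definition tilted_lik :: "real list \<Rightarrow> real" where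
  "tilted_lik r =
    (if q < length r then (avg_total_lik r + avg_deceiver_lik r) / (1 + deceiver_ratio)
     else avg_total_lik r)"

lemma tilted_lik_Nil [simp]: "tilted_lik [] = 1"
  by (simp add: tilted_lik_def avg_total_lik_def sum_\<mu>)

lemma tilted_lik_nonneg: "0 \<le> tilted_lik r"
  using avg_deceiver_lik_nonneg avg_total_lik_nonneg deceiver_ratio_nonneg
  by (simp add: tilted_lik_def)

lemma sum_tilted_lik_snoc_le:
  assumes "\<kappa> < 1"
  shows "(\<Sum>y\<in>V. tilted_lik (r @ [y])) \<le> tilted_lik r"
proof (cases "q \<le> length r")
  case True
  then have "(\<Sum>y\<in>V. tilted_lik (r @ [y]))
      = (avg_total_lik r + avg_deceiver_lik r) / (1 + deceiver_ratio)"
    by (simp add: tilted_lik_def sum.distrib sum_avg_total_lik_snoc sum_avg_deceiver_lik_snoc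
        flip: sum_divide_distrib)
  moreover have "(avg_total_lik r + avg_deceiver_lik r) / (1 + deceiver_ratio) \<le> avg_total_lik r"
    if "length r = q"
    using avg_deceiver_lik_le[of r] that assms deceiver_ratio_nonneg
    by (simp add: divide_le_eq algebra_simps)
  ultimately show ?thesis using True by (auto simp: tilted_lik_def)
qed (simp add: tilted_lik_def sum_avg_total_lik_snoc)

lemma sum_joint_lik_power_late:
  "(\<Sum>G\<in>Pow {..<n}. joint_lik G ys h * z ^ card (G \<inter> late h)) =
    (\<Prod>i<n. deceiver_lik (ys ! i) (responses i h) * (if i \<in> late h then z else 1)
      + other_lik (ys ! i) (responses i h))"
proof -
  have "joint_lik G ys h * z ^ card (G \<inter> late h) =
      (\<Prod>i<n. if i \<in> G then deceiver_lik (ys ! i) (responses i h) * (if i \<in> late h then z else 1)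
        else other_lik (ys ! i) (responses i h))" if "G \<subseteq> {..<n}" for G
  proof -
    have power_card: "z ^ card (G \<inter> late h) = (\<Prod>i<n. if i \<in> G \<inter> late h then z else 1)"
      using that by (subst prod.If_cases) (auto intro!: arg_cong[where f = "\<lambda>D. z ^ card D"])
    show ?thesis
      unfolding joint_lik_def power_card prod.distrib[symmetric] by (intro prod.cong) auto
  qed
  then show ?thesis by (simp add: prod_add_eq_sum_Pow_if)
qed

lemma sum_lists_joint_lik_two_power_late:
  "(\<Sum>ys | set ys \<subseteq> V \<and> length ys = n. (\<Prod>i<n. \<mu> (ys ! i)) *
      (\<Sum>G\<in>Pow {..<n}. joint_lik G ys h * 2 ^ card (G \<inter> late h)))
   = (\<Prod>i<n. tilted_lik (responses i h)) * (1 + deceiver_ratio) ^ card (late h)"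
proof -
  let ?norm = "\<lambda>i. if i \<in> late h then 1 + deceiver_ratio else 1"
  let ?weight = "\<lambda>i x. deceiver_lik x (responses i h) * (if i \<in> late h then 2 else 1)
    + other_lik x (responses i h)"
  have location: "(\<Sum>x\<in>V. \<mu> x * ?weight i x) = tilted_lik (responses i h) * ?norm i" if "i < n" for i
  proof -
    have "(\<Sum>x\<in>V. \<mu> x * ?weight i x) =
        avg_total_lik (responses i h) +
          (if i \<in> late h then avg_deceiver_lik (responses i h) else 0)"
      by (simp add: avg_total_lik_def avg_deceiver_lik_def other_lik_def algebra_simps
          flip: sum.distrib)
    moreover have "i \<in> late h \<longleftrightarrow> q < length (responses i h)" using that by (simp add: late_def)
    ultimately show ?thesis using deceiver_ratio_nonneg by (simp add: tilted_lik_def)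
  qed
  have "(\<Sum>ys | set ys \<subseteq> V \<and> length ys = n. (\<Prod>i<n. \<mu> (ys ! i)) *
      (\<Sum>G\<in>Pow {..<n}. joint_lik G ys h * 2 ^ card (G \<inter> late h))) =
      (\<Prod>i<n. \<Sum>x\<in>V. \<mu> x * ?weight i x)"
    unfolding sum_joint_lik_power_late prod.distrib[symmetric] by (rule sum_lists_prod_nth)
  also have "\<dots> = (\<Prod>i<n. tilted_lik (responses i h)) * (\<Prod>i<n. ?norm i)"
    by (simp add: location prod.distrib)
  also have "(\<Prod>i<n. ?norm i) = (1 + deceiver_ratio) ^ card (late h)"
    using late_subset[of h] by (simp add: prod.If_cases Int_absorb1)
  finally show ?thesis .
qed

end

lemma prod_nth_eq_prod_mset: "(\<Prod>i<length ys. f (ys ! i)) = prod_mset (image_mset f (mset ys))"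
  by (simp add: prod_mset_prod_list prod.list_conv_set_nth atLeast0LessThan flip: mset_map)

context hidden_instance
begin

definition type_class_prob :: real where
  "type_class_prob = (\<Sum>ys\<in>perms. \<Prod>i<n. \<mu> (ys ! i))"

lemma prod_nth_perms: "ys \<in> perms \<Longrightarrow> (\<Prod>i<n. f (ys ! i)) = (\<Prod>i<n. f (xs ! i))"
  using prod_nth_eq_prod_mset[of f ys] prod_nth_eq_prod_mset[of f xs] length_perms[of ys] length_xs
  by (simp add: mem_perms_iff)

lemma type_class_prob_eq: "type_class_prob = real (card perms) * (\<Prod>i<n. \<mu> (xs ! i))"
  by (simp add: type_class_prob_def prod_nth_perms)

lemma posterior_le_independent:
  assumes nonneg: "\<And>ys G. set ys \<subseteq> V \<Longrightarrow> G \<subseteq> {..<n} \<Longrightarrow> 0 \<le> \<phi> ys G" and "0 < type_class_prob"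
  shows "posterior h \<phi> \<le> (\<Sum>ys | set ys \<subseteq> V \<and> length ys = n.
    (\<Prod>i<n. \<mu> (ys ! i)) * (\<Sum>G\<in>Pow {..<n}. joint_lik G ys h * \<phi> ys G)) / type_class_prob"
proof -
  define w where "w = (\<Prod>i<n. \<mu> (xs ! i))"
  let ?weighted = "\<lambda>ys. (\<Prod>i<n. \<mu> (ys ! i)) * (\<Sum>G\<in>Pow {..<n}. joint_lik G ys h * \<phi> ys G)"
  have type_class_prob_w: "type_class_prob = real (card perms) * w"
    unfolding w_def by (rule type_class_prob_eq)
  then have "w \<noteq> 0" using assms(2) by auto
  then have "posterior h \<phi> = (\<Sum>ys\<in>perms. ?weighted ys) / type_class_prob"
    by (simp add: posterior_def type_class_prob_w prod_nth_perms flip: w_def sum_distrib_left)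
  also have "\<dots> \<le> (\<Sum>ys | set ys \<subseteq> V \<and> length ys = n. ?weighted ys) / type_class_prob"
  proof (intro divide_right_mono sum_mono2)
    show "finite {ys. set ys \<subseteq> V \<and> length ys = n}" using finite_V by (rule finite_lists_length_eq)
    show "perms \<subseteq> {ys. set ys \<subseteq> V \<and> length ys = n}"
      using set_perms_subset length_perms by auto
    show "0 \<le> ?weighted ys" if "ys \<in> {ys. set ys \<subseteq> V \<and> length ys = n} - perms" for ys
      using that nonneg nth_mem[of _ ys]
      by (intro mult_nonneg_nonneg prod_nonneg sum_nonneg joint_lik_nonneg) (auto intro!: \<mu>_nonneg)
  qed (use assms(2) in simp)
  finally show ?thesis .
qed

lemma posterior_many_late_deceivers_le:
  assumes "0 < type_class_prob"
  shows "posterior h (\<lambda>ys G. of_bool (m < real (card (G \<inter> late h)) \<and> real (card (late h)) \<le> B)) \<le>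
    (1 + deceiver_ratio) powr B / (2 powr m * type_class_prob) * (\<Prod>i<n. tilted_lik (responses i h))"
proof -
  let ?\<rho> = "1 + deceiver_ratio" and ?L = "late h"
  have ratio_ge_1: "1 \<le> ?\<rho>" using deceiver_ratio_nonneg by simp
  define c where "c = ?\<rho> powr B / (2 powr m * ?\<rho> ^ card ?L)"
  have c_nonneg: "0 \<le> c" using ratio_ge_1 by (simp add: c_def)
  have "of_bool (m < real (card (G \<inter> ?L)) \<and> real (card ?L) \<le> B) \<le> c * 2 ^ card (G \<inter> ?L)" for G
  proof (cases "m < real (card (G \<inter> ?L)) \<and> real (card ?L) \<le> B")
    case True
    then have "2 powr m \<le> 2 powr real (card (G \<inter> ?L))" "?\<rho> powr real (card ?L) \<le> ?\<rho> powr B"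
      using ratio_ge_1 by (auto intro!: powr_mono)
    then have "2 powr m * ?\<rho> ^ card ?L \<le> 2 ^ card (G \<inter> ?L) * ?\<rho> powr B"
      using ratio_ge_1 by (intro mult_mono) (auto simp: powr_realpow)
    then show ?thesis using ratio_ge_1 True by (simp add: c_def field_simps)
  qed (use c_nonneg in auto)
  then have "posterior h (\<lambda>ys G. of_bool (m < real (card (G \<inter> ?L)) \<and> real (card ?L) \<le> B))
      \<le> posterior h (\<lambda>ys G. c * 2 ^ card (G \<inter> ?L))"
    by (rule posterior_mono)
  also have "\<dots> \<le> c * ((\<Prod>i<n. tilted_lik (responses i h)) * ?\<rho> ^ card ?L / type_class_prob)"
    unfolding posterior_cmult sum_lists_joint_lik_two_power_late[symmetric]
    using c_nonneg assms by (intro mult_left_mono posterior_le_independent) auto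
  also have "\<dots> = ?\<rho> powr B / (2 powr m * type_class_prob) * (\<Prod>i<n. tilted_lik (responses i h))"
    using ratio_ge_1 by (simp add: c_def)
  finally show ?thesis .
qed

lemma hidden_prob_many_late_deceivers_le:
  assumes "\<kappa> < 1" "0 < type_class_prob"
  shows "hidden_prob t (\<lambda>ys G s. m < real (card (G \<inter> late (fst s)))
      \<and> real (card (late (fst s))) \<le> B)
    \<le> ennreal ((1 + deceiver_ratio) powr B / (2 powr m * type_class_prob))"
proof -
  define c where "c = (1 + deceiver_ratio) powr B / (2 powr m * type_class_prob)"
  have c_nonneg: "0 \<le> c" using assms(2) by (simp add: c_def)
  let ?W = "\<lambda>h. c * (\<Prod>i<n. tilted_lik (responses i h))"
  have "hidden_prob t (\<lambda>ys G s. m < real (card (G \<inter> late (fst s))) \<and> real (card (late (fst s))) \<le> B)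
      \<le> path_sum A V t (\<lambda>s. ennreal (?W (fst s)))"
    unfolding hidden_expectation_def c_def using assms(2)
    by (intro path_sum_mono ennreal_leI posterior_many_late_deceivers_le)
  also have "\<dots> \<le> ennreal (?W [])"
  proof (rule path_sum_supermartingale[OF queries_valid])
    show "0 \<le> ?W h" for h using c_nonneg by (simp add: prod_nonneg tilted_lik_nonneg)
    fix h i assume "i < n"
    then have "(\<Sum>y\<in>V. \<Prod>j<n. tilted_lik (responses j (h @ [(i, y)])))
        \<le> (\<Prod>j<n. tilted_lik (responses j h))"
      using sum_tilted_lik_snoc_le[OF assms(1), of "responses i h"]
      by (subst sum_prod_responses_snoc[where \<phi> = "\<lambda>_. tilted_lik"])
        (auto simp: prod.remove[of "{..<n}" i]
            intro!: mult_right_mono prod_nonneg tilted_lik_nonneg)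
    then show "(\<Sum>y\<in>V. ?W (h @ [(i, y)])) \<le> ?W h"
      using c_nonneg by (simp add: mult_left_mono flip: sum_distrib_left)
  qed
  finally show ?thesis by (simp add: c_def)
qed

subsection \<open>The error probability\<close>

lemma hidden_prob_many_late_le:
  assumes cost: "\<And>ys. ys \<in> perms \<Longrightarrow> query_complexity A ys \<le> ennreal T" and "0 \<le> T" "0 < B"
  shows "hidden_prob t (\<lambda>ys G s. B < real (card (late (fst s)))) \<le> ennreal (T / (real (q + 1) * B))"
proof (rule hidden_prob_le_of_run)
  fix ys c assume perm: "ys \<in> perms"
  let ?M = "run A (fake_adv ys c) ys t" and ?r = "1 / (real (q + 1) * B)"
  have "1 \<le> ennreal ?r * of_nat (length h)" if "B < real (card (late h))" for h
  proof -
    have "real (q + 1) * B \<le> real ((q + 1) * card (late h))"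
      unfolding of_nat_mult using that by (intro mult_left_mono) auto
    also have "\<dots> \<le> real (length h)" using card_late_le by (rule of_nat_mono)
    finally have "1 \<le> ?r * real (length h)"
      using \<open>0 < B\<close> by (simp add: pos_le_divide_eq)
    then show ?thesis
      using \<open>0 < B\<close>
      by (simp add: ennreal_of_nat_eq_real_of_nat del: of_nat_add of_nat_Suc flip: ennreal_mult)
  qed
  then have "emeasure ?M {s. B < real (card (late (fst s)))} \<le>
      emeasure ?M {s \<in> UNIV. 1 \<le> ennreal ?r * of_nat (length (fst s))}"
    by (intro emeasure_mono) auto
  also have "\<dots> \<le> ennreal ?r * (\<integral>\<^sup>+ s. of_nat (length (fst s)) * indicator UNIV s \<partial>?M)"
    by (rule nn_integral_Markov_inequality) auto
  also have "\<dots> \<le> ennreal ?r * ennreal T"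
    using order_trans[OF nn_integral_length_le_query_complexity cost[OF perm]]
    by (intro mult_left_mono) auto
  also have "\<dots> = ennreal (T / (real (q + 1) * B))"
    using assms(2,3) by (simp flip: ennreal_mult)
  finally show "emeasure ?M {s. B < real (card (late (fst s)))}
      \<le> ennreal (T / (real (q + 1) * B))" .
qed

lemma hidden_prob_typical_no_survivor_le:
  assumes "0 \<le> m" "m < g"
  shows "hidden_prob t (\<lambda>ys G s. typical g m G (fst s) \<and> hits P (G - late (fst s)) ys = 0)
    \<le> ennreal ((1 - deceiver_prob) ^ hits P {..<n} xs + m / g)"
proof -
  have "hidden_prob t (\<lambda>ys G s. typical g m G (fst s) \<and> hits P (G - late (fst s)) ys = 0)
    \<le> hidden_expectation t (\<lambda>ys G s. of_bool (hits P G ys = 0) +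
        of_bool (typical g m G (fst s) \<and>
          0 < hits P G ys \<and> hits P (G - late (fst s)) ys = 0))"
    by (intro hidden_expectation_mono) (auto simp: of_bool_def)
  also have "\<dots> \<le> ennreal ((1 - deceiver_prob) ^ hits P {..<n} xs + m / g)"
    using assms deceiver_prob_le_1
    by (intro hidden_expectation_add_le hidden_prob_no_hits_le hidden_prob_no_survivor_le) auto
  finally show ?thesis .
qed

theorem success_probability_le:
  fixes v p \<eta> m g :: real
  assumes correct: "\<And>ys c. ys \<in> perms \<Longrightarrow> c \<in> fake_choices \<Longrightarrow>
      p \<le> measure_pmf.prob (run A (fake_adv ys c) ys t) (correct_states v ys)"
    and atypical: "hidden_prob t (\<lambda>ys G s. \<not> typical g m G (fst s)) \<le> ennreal \<eta>"
    and "0 \<le> \<eta>" "0 \<le> m" "m < g"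
  shows "2 * p \<le> 1 + (\<eta> + ((1 - deceiver_prob) ^ num_ge v xs + m / g
    + ((1 - deceiver_prob) ^ (n - num_ge v xs) + m / g)))" (is "_ \<le> 1 + (\<eta> + (?high + ?low))")
proof -
  have high: "num_ge v xs = hits (\<lambda>x. v \<le> x) {..<n} xs"
    by (simp add: num_ge_eq_hits length_xs)
  then have low: "n - num_ge v xs = hits (\<lambda>x. \<not> v \<le> x) {..<n} xs"
    by (simp only: hits_Not[OF finite_lessThan] card_lessThan)
  let ?no_survivor = "\<lambda>P ys G s. hits P (G - late (fst s)) ys = 0"
  have "ennreal p \<le> hidden_prob t (\<lambda>ys _ s. s \<in> correct_states v ys)"
    using correct by (intro hidden_prob_ge_of_run)
      (simp add: measure_pmf.emeasure_eq_measure ennreal_leI)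
  then have "ennreal (2 * p) \<le> 2 * hidden_prob t (\<lambda>ys _ s. s \<in> correct_states v ys)"
    by (simp add: ennreal_mult' mult_left_mono)
  also have "\<dots> \<le> hidden_expectation t (\<lambda>ys G s. 1 +
      of_bool (?no_survivor (\<lambda>x. v \<le> x) ys G s \<or> ?no_survivor (\<lambda>x. \<not> v \<le> x) ys G s))"
    by (rule hidden_prob_correct_le)
  also have "\<dots> \<le> hidden_expectation t (\<lambda>ys G s. 1 +
      (of_bool (\<not> typical g m G (fst s)) +
        (of_bool (typical g m G (fst s) \<and> ?no_survivor (\<lambda>x. v \<le> x) ys G s) +
         of_bool (typical g m G (fst s) \<and> ?no_survivor (\<lambda>x. \<not> v \<le> x) ys G s))))"
    by (intro hidden_expectation_mono) (auto simp: of_bool_def not_less)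
  also have "\<dots> \<le> ennreal (1 + (\<eta> + (?high + ?low)))"
    unfolding low unfolding high
  proof (intro hidden_expectation_add_le atypical hidden_prob_typical_no_survivor_le)
    show "hidden_expectation t (\<lambda>_ _ _. 1) \<le> ennreal 1"
      by (rule hidden_expectation_static_le) (simp_all add: sum_deceiver_set_prob)
  qed (use assms deceiver_prob_le_1 in auto)
  finally have "ennreal (2 * p) \<le> ennreal (1 + (\<eta> + (?high + ?low)))" .
  moreover have "0 \<le> 1 + (\<eta> + (?high + ?low))"
    using assms(3-5) deceiver_prob_le_1 by simp
  ultimately show ?thesis by (simp only: ennreal_le_iff)
qed

end

section \<open>The probability of a type class\<close>

lemma power_le_fact_mult_exp:
  fixes x :: real
  assumes "0 \<le> x"
  shows "x ^ n \<le> fact n * exp x"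
proof -
  have "(\<Sum>k\<in>{n}. inverse (fact k) * x ^ k) \<le> (\<Sum>k. inverse (fact k) * x ^ k)"
    using assms by (intro sum_le_suminf summable_exp) auto
  also have "\<dots> = exp x" by (simp add: exp_def divide_inverse mult.commute)
  finally show ?thesis by (simp add: field_simps)
qed

lemma fact_mult_exp_le:
  assumes "1 \<le> m"
  shows "fact m * exp (real m) \<le> exp 1 * real m * real m ^ m"
  using assms
proof (induction m rule: dec_induct)
  case (step m)
  have "real m / real (Suc m) = 1 + (- 1 / real (Suc m))" by (simp add: field_simps)
  also have "\<dots> \<le> exp (- 1 / real (Suc m))" by (rule exp_ge_add_one_self)
  finally have "(real m / real (Suc m)) ^ Suc m \<le> exp (- 1 / real (Suc m)) ^ Suc m"
    by (intro power_mono) auto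
  also have "\<dots> = exp (-1)"
    by (simp add: exp_of_nat_mult[symmetric] del: power_Suc of_nat_Suc)
  finally have "exp 1 * real m ^ Suc m \<le> real (Suc m) ^ Suc m"
    by (simp add: power_divide exp_minus field_simps del: power_Suc)
  then have "(real (Suc m) * exp 1) * (exp 1 * real m ^ Suc m) \<le>
      (real (Suc m) * exp 1) * real (Suc m) ^ Suc m"
    by (intro mult_left_mono) auto
  moreover have "(real (Suc m) * exp 1) * (fact m * exp (real m)) \<le>
      (real (Suc m) * exp 1) * (exp 1 * real m ^ Suc m)"
    using step.IH by (intro mult_left_mono) (auto simp: mult_ac)
  ultimately show ?case by (simp add: exp_add algebra_simps)
qed simp

definition empirical :: "'a list \<Rightarrow> 'a \<Rightarrow> real" where
  "empirical xs x = real (count (mset xs) x) / real (length xs)"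

lemma sum_count_mset: "(\<Sum>x\<in>set xs. count (mset xs) x) = length xs"
  by (simp add: size_multiset_overloaded_eq flip: size_mset)

lemma sum_empirical: "xs \<noteq> [] \<Longrightarrow> (\<Sum>x\<in>set xs. empirical xs x) = 1"
  by (simp add: empirical_def sum_count_mset flip: sum_divide_distrib of_nat_sum)

lemma prod_nth_empirical:
  "(\<Prod>i<length xs. empirical xs (xs ! i)) =
    (\<Prod>x\<in>set xs. real (count (mset xs) x) ^ count (mset xs) x) / real (length xs) ^ length xs"
  unfolding prod_nth_eq_prod_mset image_prod_mset_multiplicity
  by (simp add: empirical_def power_divide prod_dividef sum_count_mset flip: power_sum)

lemma prod_fact_count_mult_exp_le:
  fixes xs :: "'a list"
  defines "n \<equiv> length xs"
  shows "(\<Prod>x\<in>set xs. fact (count (mset xs) x)) * exp (real n) \<le>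
    (exp 1 * real n) ^ card (set xs) * (\<Prod>x\<in>set xs. real (count (mset xs) x) ^ count (mset xs) x)"
proof -
  let ?count = "count (mset xs)"
  have "fact (?count x) * exp (real (?count x)) \<le> (exp 1 * real n) * real (?count x) ^ ?count x"
    if "x \<in> set xs" for x
  proof -
    have "fact (?count x) * exp (real (?count x))
        \<le> exp 1 * real (?count x) * real (?count x) ^ ?count x"
      using that by (intro fact_mult_exp_le) (simp add: Suc_le_eq)
    also have "\<dots> \<le> exp 1 * real n * real (?count x) ^ ?count x"
      using count_le_size[of "mset xs" x]
      by (intro mult_right_mono mult_left_mono) (auto simp: n_def)
    finally show ?thesis .
  qed
  then have "(\<Prod>x\<in>set xs. fact (?count x) * exp (real (?count x))) \<le>
      (\<Prod>x\<in>set xs. (exp 1 * real n) * real (?count x) ^ ?count x)"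
    by (intro prod_mono) auto
  moreover have "(\<Prod>x\<in>set xs. exp (real (?count x))) = exp (real n)"
    by (simp add: n_def sum_count_mset flip: exp_sum of_nat_sum)
  ultimately show ?thesis by (simp add: prod.distrib)
qed

text \<open>
  The first two factors are the probability that independent draws from the empirical distribution
  of \<open>xs\<close> form a permutation of \<open>xs\<close>.
\<close>

lemma one_le_permutations_mult_prod_empirical:
  assumes "xs \<noteq> []"
  defines "n \<equiv> length xs"
  shows "1 \<le> real (card (permutations_of_multiset (mset xs))) * (\<Prod>i<n. empirical xs (xs ! i))
    * exp (real (card (set xs)) * (1 + ln (real n)))"
proof -
  let ?count = "count (mset xs)" and ?K = "real (card (permutations_of_multiset (mset xs)))"
  have "?K * (\<Prod>x\<in>set xs. fact (?count x)) = fact n"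
    using arg_cong[OF card_permutations_of_multiset_aux[of "mset xs"], of real] by (simp add: n_def)
  then have "real n ^ n \<le> ?K * ((\<Prod>x\<in>set xs. fact (?count x)) * exp (real n))"
    using power_le_fact_mult_exp[of "real n" n] by (simp add: mult_ac)
  also have "\<dots> \<le> ?K * ((exp 1 * real n) ^ card (set xs) * (\<Prod>x\<in>set xs. real (?count x) ^ ?count x))"
    unfolding n_def by (intro mult_left_mono prod_fact_count_mult_exp_le) auto
  also have "(exp 1 * real n) ^ card (set xs) = exp (real (card (set xs)) * (1 + ln (real n)))"
    using assms(1) by (subst exp_of_nat_mult) (simp add: n_def exp_add)
  finally show ?thesis
    unfolding n_def prod_nth_empirical using assms(1) by (simp add: le_divide_eq mult_ac)
qed

section \<open>Lower bounds for a single instance\<close>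

definition instance_query_complexity :: "algorithm \<Rightarrow> real list \<Rightarrow> ennreal" where
  "instance_query_complexity A xs
      = (SUP ys\<in>permutations_of_multiset (mset xs). query_complexity A ys)"

lemma instance_query_complexity_attained:
  "\<exists>ys. mset ys = mset xs \<and> query_complexity A ys = instance_query_complexity A xs"
proof -
  let ?costs = "query_complexity A ` permutations_of_multiset (mset xs)"
  have "Max ?costs \<in> ?costs" by (intro Max_in) auto
  moreover have "instance_query_complexity A xs = Max ?costs"
    unfolding instance_query_complexity_def by (intro cSup_eq_Max) auto
  ultimately have "instance_query_complexity A xs \<in> ?costs" by simp
  then show ?thesis by (metis imageE permutations_of_multisetD)
qed

lemma query_complexity_le_instance_query_complexity:
  "mset ys = mset xs \<Longrightarrow> query_complexity A ys \<le> instance_query_complexity A xs"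
  unfolding instance_query_complexity_def by (intro SUP_upper permutations_of_multisetI)

lemma instance_query_complexity_geI:
  fixes b :: real
  assumes "\<And>T. 0 \<le> T \<Longrightarrow> (\<And>ys. mset ys = mset xs \<Longrightarrow> query_complexity A ys \<le> ennreal T) \<Longrightarrow> b \<le> T"
  shows "ennreal b \<le> instance_query_complexity A xs"
proof (cases "instance_query_complexity A xs")
  case (real T)
  then have "b \<le> T"
    using assms[of T] query_complexity_le_instance_query_complexity[of _ xs A] by simp
  then show ?thesis by (simp add: real ennreal_leI)
qed simp

lemma num_ge_le_length: "num_ge v xs \<le> length xs"
  by (simp add: num_ge_eq_hits hits_def card_mono[of "{..<length xs}", simplified] subset_eq)

lemma one_minus_power_le_exp:
  fixes x :: real
  assumes "x \<le> 1"
  shows "(1 - x) ^ j \<le> exp (- (x * real j))"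
proof -
  have "(1 - x) ^ j \<le> exp (- x) ^ j"
    using assms exp_ge_add_one_self[of "- x"] by (intro power_mono) auto
  then show ?thesis by (simp flip: exp_of_nat2_mult)
qed

context hidden_instance
begin

lemma ex_common_success_time:
  assumes "correct_given_multiset A v (mset xs)" "p < 2/3"
  shows "\<exists>t. \<forall>ys\<in>perms. \<forall>c\<in>fake_choices.
    p \<le> measure_pmf.prob (run A (fake_adv ys c) ys t) (correct_states v ys)"
proof -
  have "\<forall>\<^sub>F t in sequentially. \<forall>ys\<in>perms. \<forall>c\<in>fake_choices.
      p \<le> measure_pmf.prob (run A (fake_adv ys c) ys t) (correct_states v ys)"
    using assms
    by (intro eventually_ball_finite finite_perms finite_fake_choices ballI solves_threshold_eventually)
      (auto simp: correct_given_multiset_def mem_perms_iff)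
  then show ?thesis by (rule eventually_happens'[OF sequentially_bot])
qed

lemma hidden_prob_atypical_le_of_certain:
  assumes certain: "deceiver_prob = 1" and "0 \<le> T" "0 < B"
    and "\<And>ys. ys \<in> perms \<Longrightarrow> query_complexity A ys \<le> ennreal T"
  shows "hidden_prob t (\<lambda>ys G s. \<not> typical (real n) B G (fst s))
    \<le> ennreal (T / (real (q + 1) * B))"
proof -
  have "hidden_prob t (\<lambda>ys G s. \<not> typical (real n) B G (fst s))
      \<le> hidden_expectation t (\<lambda>ys G s. of_bool (real (card G) < real n)
          + of_bool (B < real (card (late (fst s)))))"
  proof (rule hidden_expectation_mono)
    fix ys G and s :: run_state
    have "real (card (G \<inter> late (fst s))) \<le> real (card (late (fst s)))"
      by (intro of_nat_mono card_mono) auto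
    then show "of_bool (\<not> typical (real n) B G (fst s)) \<le>
        (of_bool (real (card G) < real n) + of_bool (B < real (card (late (fst s)))) :: real)"
      by (auto simp: of_bool_def typical_def)
  qed
  also have "\<dots> \<le> ennreal (0 + T / (real (q + 1) * B))"
  proof (intro hidden_expectation_add_le hidden_prob_many_late_le hidden_expectation_static_le)
    have "deceiver_set_prob G * of_bool (real (card G) < real n) = 0" if "G \<subseteq> {..<n}" for G
    proof (cases "G = {..<n}")
      case False
      then have "deceiver_set_prob G = 0"
        using that unfolding deceiver_set_prob_def certain by (intro prod_zero) auto
      then show ?thesis by simp
    qed simp
    then show "(\<Sum>G\<in>Pow {..<n}. deceiver_set_prob G * of_bool (real (card G) < real n)) \<le> 0"
      by (intro eq_refl sum.neutral) auto
  qed (use assms in auto)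
  finally show ?thesis by simp
qed

lemma hidden_prob_few_deceivers_le:
  "hidden_prob t (\<lambda>ys G s. real (card G) < g)
    \<le> ennreal (2 powr g * exp (- (deceiver_prob / 2 * real n)))"
proof (rule hidden_expectation_static_le)
  have "(\<Sum>G\<in>Pow {..<n}. deceiver_set_prob G * of_bool (real (card G) < g))
      \<le> 2 powr g * (1 - deceiver_prob / 2) ^ n"
    by (rule sum_deceiver_set_prob_few_le)
  also have "\<dots> \<le> 2 powr g * exp (- (deceiver_prob / 2 * real n))"
    using deceiver_prob_le_1 by (intro mult_left_mono one_minus_power_le_exp) auto
  finally show "(\<Sum>G\<in>Pow {..<n}. deceiver_set_prob G * of_bool (real (card G) < g))
      \<le> 2 powr g * exp (- (deceiver_prob / 2 * real n))" .
qed simp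

lemma hidden_prob_atypical_le:
  assumes "\<kappa> < 1" "0 < type_class_prob" "0 \<le> T" "0 < B"
    and "\<And>ys. ys \<in> perms \<Longrightarrow> query_complexity A ys \<le> ennreal T"
  shows "hidden_prob t (\<lambda>ys G s. \<not> typical g m G (fst s)) \<le>
    ennreal (2 powr g * exp (- (deceiver_prob / 2 * real n)) +
      ((1 + deceiver_ratio) powr B / (2 powr m * type_class_prob) + T / (real (q + 1) * B)))"
proof -
  have "hidden_prob t (\<lambda>ys G s. \<not> typical g m G (fst s))
      \<le> hidden_expectation t (\<lambda>ys G s. of_bool (real (card G) < g) +
          (of_bool (m < real (card (G \<inter> late (fst s))) \<and> real (card (late (fst s))) \<le> B)
            + of_bool (B < real (card (late (fst s))))))"
    by (intro hidden_expectation_mono) (auto simp: of_bool_def typical_def)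
  also have "\<dots> \<le> ennreal (2 powr g * exp (- (deceiver_prob / 2 * real n)) +
      ((1 + deceiver_ratio) powr B / (2 powr m * type_class_prob) + T / (real (q + 1) * B)))"
    using assms
    by (intro hidden_expectation_add_le hidden_prob_few_deceivers_le hidden_prob_many_late_deceivers_le
        hidden_prob_many_late_le) auto
  finally show ?thesis .
qed

lemma error_terms_ge:
  assumes "\<kappa> < 1" "0 < type_class_prob" "0 \<le> T" "0 < B" "0 \<le> m" "m < g"
    and correct: "correct_given_multiset A v (mset xs)"
    and cost: "\<And>ys. ys \<in> perms \<Longrightarrow> query_complexity A ys \<le> ennreal T"
  shows "1/4 \<le> 2 powr g * exp (- (deceiver_prob / 2 * real n)) +
      ((1 + deceiver_ratio) powr B / (2 powr m * type_class_prob) + T / (real (q + 1) * B)) +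
      ((1 - deceiver_prob) ^ num_ge v xs + m / g + ((1 - deceiver_prob) ^ (n - num_ge v xs) + m / g))"
    (is "_ \<le> ?total")
proof -
  obtain t where success: "\<And>ys c. ys \<in> perms \<Longrightarrow> c \<in> fake_choices \<Longrightarrow>
      5/8 \<le> measure_pmf.prob (run A (fake_adv ys c) ys t) (correct_states v ys)"
    using ex_common_success_time[OF correct, of "5/8"] by auto
  have "2 * (5/8) \<le> 1 + ?total"
    using assms(1-6) cost deceiver_ratio_nonneg
    by (intro success_probability_le[OF success hidden_prob_atypical_le]) auto
  then show ?thesis by simp
qed

lemma one_le_type_class_prob_mult_exp:
  assumes "\<mu> = empirical xs" "0 < n"
  shows "1 \<le> type_class_prob * exp (real (card (set xs)) * (1 + ln (real n)))"
  unfolding type_class_prob_eq perms_def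
  unfolding assms(1) length_xs[symmetric]
  using assms(2) length_xs by (intro one_le_permutations_mult_prod_empirical) auto

end

lemma hidden_instance_empirical:
  assumes "xs \<noteq> []" "0 \<le> \<kappa>" "\<kappa> \<le> 1" "algorithm_on (length xs) A"
  shows "hidden_instance (length xs) (set xs) (empirical xs) \<kappa> xs A"
proof
  show "sum (empirical xs) (set xs) = 1" by (rule sum_empirical[OF assms(1)])
qed (use assms in \<open>auto simp: empirical_def\<close>)

text \<open>With \<open>\<kappa> = 1\<close> and \<open>q = 0\<close> all locations are deceivers, and late as soon as they are queried.\<close>

lemma instance_query_complexity_ge_linear:
  fixes xs :: "real list" and v :: real
  defines "n \<equiv> length xs" and "k \<equiv> num_ge v xs"
  assumes queries_valid: "algorithm_on n A" and k_bounds: "0 < k" "k < n"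
    and correct: "correct_given_multiset A v (mset xs)"
  shows "ennreal (real n / 128) \<le> instance_query_complexity A xs"
proof (rule instance_query_complexity_geI)
  fix T :: real assume T_nonneg: "0 \<le> T"
    and cost: "\<And>ys. mset ys = mset xs \<Longrightarrow> query_complexity A ys \<le> ennreal T"
  interpret hidden_instance n "set xs" "empirical xs" 1 0 xs A
    unfolding n_def using queries_valid k_bounds
    by (intro hidden_instance_empirical) (auto simp: n_def)
  have certain: "deceiver_prob = 1" by (simp add: deceiver_prob_def)
  obtain t where success: "\<And>ys c. ys \<in> perms \<Longrightarrow> c \<in> fake_choices \<Longrightarrow>
      5/8 \<le> measure_pmf.prob (run A (fake_adv ys c) ys t) (correct_states v ys)"
    using ex_common_success_time[OF correct, of "5/8"] by auto
  have "2 * (5/8) \<le> 1 + (T / (real (0 + 1) * (real n / 16)) +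
      ((1 - deceiver_prob) ^ k + real n / 16 / real n +
       ((1 - deceiver_prob) ^ (n - k) + real n / 16 / real n)))"
    unfolding k_def using T_nonneg k_bounds cost
    by (intro success_probability_le[OF success hidden_prob_atypical_le_of_certain[OF certain]])
      (auto simp: mem_perms_iff)
  then show "real n / 128 \<le> T" using k_bounds by (simp add: certain power_0_left field_simps)
qed

lemma exp_minus_4_le: "exp (- 4) \<le> (1/32 :: real)"
proof -
  have "(5/2 :: real) \<le> exp 1" using exp_lower_Taylor_quadratic[of 1] by simp
  then have "(5/2 :: real) ^ 4 \<le> exp 1 ^ 4" by (intro power_mono) auto
  then have "32 \<le> exp (4 :: real)" by (simp add: exp_of_nat_mult[symmetric] power_divide)
  then show ?thesis by (simp add: exp_minus field_simps)
qed

lemma two_powr_mult_exp_le: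
  fixes x :: real
  assumes "32 \<le> x"
  shows "2 powr (x / 8) * exp (- (x / 4)) \<le> 1/32"
proof -
  have "2 powr (x / 8) \<le> exp (x / 8)"
    using assms ln_le_minus_one[of 2] by (simp add: powr_def)
  then have "2 powr (x / 8) * exp (- (x / 4)) \<le> exp (x / 8) * exp (- (x / 4))"
    by (intro mult_right_mono) auto
  also have "\<dots> \<le> exp (- 4)" using assms by (simp flip: exp_add)
  finally show ?thesis using exp_minus_4_le by linarith
qed

lemma one_minus_power_le:
  fixes x :: real
  assumes "x \<le> 1" "4 \<le> x * real j"
  shows "(1 - x) ^ j \<le> 1/32"
proof -
  have "(1 - x) ^ j \<le> exp (- (x * real j))" by (rule one_minus_power_le_exp[OF assms(1)])
  also have "\<dots> \<le> exp (- 4)" using assms(2) by simp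
  finally show ?thesis using exp_minus_4_le by linarith
qed

lemma one_plus_powr_divide_le:
  fixes p n z w :: real
  assumes "0 \<le> p" "0 \<le> n" "0 < w" "1 \<le> w * z" "z * 32 \<le> exp (n * p / 2048)"
  shows "(1 + p) powr (n / 2048) / (2 powr (n * p / 512) * w) \<le> 1/32"
proof -
  have "(1 + p) powr (n / 2048) \<le> exp p powr (n / 2048)"
    using assms(1,2) by (intro powr_mono2 exp_ge_add_one_self) auto
  also have "\<dots> = exp (n * p / 2048) * 1" by (simp add: powr_def mult.commute)
  also have "\<dots> \<le> exp (n * p / 2048) * (w * z)"
    using assms(4) by (intro mult_left_mono) auto
  finally have "(1 + p) powr (n / 2048) * 32 \<le> exp (n * p / 2048) * w * (z * 32)"
    by (simp add: mult_ac)
  also have "\<dots> \<le> exp (n * p / 2048) * w * exp (n * p / 2048)"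
    using assms(3,5) by (intro mult_left_mono) auto
  also have "\<dots> = exp (1/2 * (n * p / 512)) * w"
    by (simp flip: exp_add)
  also have "\<dots> \<le> exp (ln 2 * (n * p / 512)) * w"
  proof -
    have "1/2 * (n * p / 512) \<le> ln 2 * (n * p / 512)"
      using ln2_ge_two_thirds assms(1,2) by (intro mult_right_mono) auto
    then show ?thesis using assms(3) by (intro mult_right_mono) auto
  qed
  also have "exp (ln 2 * (n * p / 512)) = 2 powr (n * p / 512)"
    by (simp add: powr_def mult.commute)
  finally show ?thesis using assms(3) by (simp add: divide_le_eq)
qed

text \<open>
  The error terms must add up to at least \<open>2 * (5/8) - 1 = 1/4\<close>. The constants make all of them
  together at most \<open>5/32\<close>, apart from the one bounded by the number of queries.
\<close>

lemma instance_query_complexity_ge_deceit_length: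
  fixes xs :: "real list" and v :: real and q :: nat
  defines "n \<equiv> length xs" and "k \<equiv> num_ge v xs" and "p \<equiv> (1/3 :: real) ^ q"
  assumes queries_valid: "algorithm_on n A" and correct: "correct_given_multiset A v (mset xs)"
    and deceivers: "16 \<le> p * real k" "16 \<le> p * real (n - k)"
    and types: "real (card (set xs)) * (1 + ln (real n)) + ln 32 \<le> real n * p / 2048"
  shows "ennreal (real (q + 1) * real n / 32768) \<le> instance_query_complexity A xs"
proof (rule instance_query_complexity_geI)
  fix T :: real assume T_nonneg: "0 \<le> T"
    and cost: "\<And>ys. mset ys = mset xs \<Longrightarrow> query_complexity A ys \<le> ennreal T"
  have p_bounds: "0 < p" "p \<le> 1" by (auto simp: p_def power_le_one)
  have "k \<le> n" unfolding k_def n_def by (rule num_ge_le_length)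
  then have np_ge: "32 \<le> real n * p" using deceivers by (simp add: of_nat_diff algebra_simps)
  then have n_pos: "0 < n" by (cases n) auto
  interpret hidden_instance n "set xs" "empirical xs" "1/2" q xs A
    unfolding n_def using queries_valid n_pos
    by (intro hidden_instance_empirical) (auto simp: n_def)
  have deceiver_prob: "deceiver_prob = p / 2" by (simp add: deceiver_prob_def p_def)
  have deceiver_ratio: "deceiver_ratio = p" by (simp add: deceiver_ratio_def deceiver_prob)
  let ?g = "real n * p / 8" and ?m = "real n * p / 512" and ?B = "real n / 2048"
  let ?z = "exp (real (card (set xs)) * (1 + ln (real n)))"
  have type_class_prob_ge: "1 \<le> type_class_prob * ?z"
    by (rule one_le_type_class_prob_mult_exp[OF refl n_pos])
  then have type_class_prob_pos: "0 < type_class_prob"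
    by (rule zero_less_mult_pos2[OF order_less_le_trans[OF zero_less_one]]) simp
  define few where "few = 2 powr ?g * exp (- (deceiver_prob / 2 * real n))"
  define many where "many = (1 + deceiver_ratio) powr ?B / (2 powr ?m * type_class_prob)"
  have few_le: "few \<le> 1/32"
    using two_powr_mult_exp_le[OF np_ge] by (simp add: few_def deceiver_prob mult.commute)
  have "?z * 32 \<le> exp (real n * p / 2048)"
    using iffD2[OF exp_le_cancel_iff types] by (simp add: exp_add)
  then have many_le: "many \<le> 1/32"
    unfolding many_def deceiver_ratio using p_bounds type_class_prob_pos type_class_prob_ge
    by (intro one_plus_powr_divide_le[where z = ?z]) auto
  have "1/4 \<le> few + (many + T / (real (q + 1) * ?B)) +
      ((1 - deceiver_prob) ^ k + ?m / ?g + ((1 - deceiver_prob) ^ (n - k) + ?m / ?g))"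
    unfolding k_def few_def many_def using cost T_nonneg p_bounds n_pos type_class_prob_pos correct
    by (intro error_terms_ge) (auto simp: mem_perms_iff)
  moreover have "(1 - deceiver_prob) ^ k \<le> 1/32" "(1 - deceiver_prob) ^ (n - k) \<le> 1/32"
    using deceivers by (intro one_minus_power_le deceiver_prob_le_1; simp add: deceiver_prob)+
  moreover have "?m / ?g = 1/64" using n_pos p_bounds by simp
  ultimately have "1/16 \<le> T / (real (q + 1) * ?B)" using few_le many_le by linarith
  then have "1/16 * (real (q + 1) * ?B) \<le> T"
    using n_pos by (subst (asm) pos_le_divide_eq) simp_all
  then show "real (q + 1) * real n / 32768 \<le> T" by simp
qed

lemma emeasure_run_unqueried_cong:
  fixes ys zs :: "real list"
  assumes queries_valid: "algorithm_on n A" and agree: "\<And>j. j < n \<Longrightarrow> j \<noteq> i \<Longrightarrow> ys ! j = zs ! j"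
  shows "emeasure (run A (persistent_adv ((!) ys)) ys t) {s. s \<in> E \<and> responses i (fst s) = []} =
    emeasure (run A (persistent_adv ((!) zs)) zs t) {s. s \<in> E \<and> responses i (fst s) = []}"
    (is "?prob ys = ?prob zs")
proof -
  let ?F = "{s. s \<in> E \<and> responses i (fst s) = []}"
  define V where "V = (!) ys ` {..<n} \<union> (!) zs ` {..<n}"
  have path_sum: "?prob xs = path_sum A V t
      (\<lambda>s. ennreal (history_likelihood n xs ((!) xs) (fst s)) * indicator ?F s)"
    if "\<And>j. j < n \<Longrightarrow> xs ! j \<in> V" for xs
    using nn_integral_run_eq_path_sum[OF queries_valid _ that that, where \<phi> = "indicator ?F"]
    by (simp add: V_def)
  have "history_likelihood n ys ((!) ys) (fst s) = history_likelihood n zs ((!) zs) (fst s)"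
    if "s \<in> ?F" for s
    unfolding history_likelihood_def
  proof (intro prod.cong refl)
    fix j assume "j \<in> {..<n}"
    then show "likelihood (ys ! j) (ys ! j) (responses j (fst s)) =
        likelihood (zs ! j) (zs ! j) (responses j (fst s))"
      using that agree[of j] by (cases "j = i") auto
  qed
  then have "(\<lambda>s. ennreal (history_likelihood n ys ((!) ys) (fst s)) * indicator ?F s) =
      (\<lambda>s. ennreal (history_likelihood n zs ((!) zs) (fst s)) * indicator ?F s)"
    by (auto simp: fun_eq_iff indicator_def)
  then show ?thesis by (simp add: path_sum V_def)
qed

lemma prob_queried_ge:
  fixes ys zs :: "real list"
  assumes queries_valid: "algorithm_on n A" and agree: "\<And>j. j < n \<Longrightarrow> j \<noteq> i \<Longrightarrow> ys ! j = zs ! j"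
    and distinct: "threshold_set v ys \<noteq> threshold_set v zs"
    and correct: "\<And>xs. xs \<in> {ys, zs} \<Longrightarrow>
      p \<le> measure_pmf.prob (run A (persistent_adv ((!) xs)) xs t) (correct_states v xs)"
  shows "2 * p - 1 \<le> measure_pmf.prob (run A (persistent_adv ((!) ys)) ys t)
      {s. responses i (fst s) \<noteq> []}"
proof -
  let ?P = "\<lambda>xs. measure_pmf.prob (run A (persistent_adv ((!) xs)) xs t)"
  let ?queried = "{s :: run_state. responses i (fst s) \<noteq> []}"
  let ?blind = "{s. s \<in> correct_states v ys \<and> responses i (fst s) = []}"
  have "?P ys ?blind = ?P zs ?blind"
    using emeasure_run_unqueried_cong[OF queries_valid agree, where t = t and E = "correct_states v ys"]
    by (simp add: measure_def)
  moreover have "?P zs ?blind + ?P zs (correct_states v zs) \<le> 1"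
    using distinct
    by (subst measure_pmf.finite_measure_Union[symmetric]) (auto simp: correct_states_def)
  moreover have "?P ys (correct_states v ys) \<le> ?P ys ?blind + ?P ys ?queried"
    by (intro order_trans[OF measure_pmf.finite_measure_mono measure_Un_le]) auto
  ultimately show ?thesis using correct[of ys] correct[of zs] by simp
qed

lemma sum_prob_queried_le_query_complexity:
  "ennreal (\<Sum>i<n. measure_pmf.prob (run A adv ys t) {s. responses i (fst s) \<noteq> []})
    \<le> query_complexity A ys"
proof -
  let ?M = "run A adv ys t"
  have "ennreal (\<Sum>i<n. measure_pmf.prob ?M {s. responses i (fst s) \<noteq> []}) =
      (\<Sum>i<n. \<integral>\<^sup>+ s. indicator {s. responses i (fst s) \<noteq> []} s \<partial>?M)"
    by (simp add: measure_pmf.emeasure_eq_measure)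
  also have "\<dots> = (\<integral>\<^sup>+ s. (\<Sum>i<n. indicator {s. responses i (fst s) \<noteq> []} s) \<partial>?M)"
    by (rule nn_integral_sum[symmetric]) auto
  also have "\<dots> \<le> (\<integral>\<^sup>+ s. of_nat (length (fst s)) \<partial>?M)"
  proof (intro nn_integral_mono)
    fix s :: run_state
    have "(\<Sum>i<n. indicator {s. responses i (fst s) \<noteq> []} s :: ennreal) \<le>
        (\<Sum>i<n. of_nat (length (responses i (fst s))))"
    proof (rule sum_mono)
      show "indicator {s. responses i (fst s) \<noteq> []} s
          \<le> (of_nat (length (responses i (fst s))) :: ennreal)"
        for i by (cases "responses i (fst s)") (auto simp: indicator_def)
    qed
    also have "\<dots> \<le> of_nat (length (fst s))"
      unfolding of_nat_sum[symmetric] by (intro of_nat_mono sum_length_responses_le) auto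
    finally show "(\<Sum>i<n. indicator {s. responses i (fst s) \<noteq> []} s :: ennreal)
        \<le> of_nat (length (fst s))" .
  qed
  also have "\<dots> \<le> query_complexity A ys" by (rule nn_integral_length_le_query_complexity)
  finally show ?thesis .
qed

lemma query_complexity_ge_of_correct_on_all_inputs:
  fixes xs :: "real list" and v :: real
  defines "n \<equiv> length xs"
  assumes queries_valid: "algorithm_on n A" and correct: "correct_on_all_inputs A v n"
  shows "ennreal (real n / 4) \<le> query_complexity A xs"
proof -
  define flip where "flip i = xs[i := if v \<le> xs ! i then v - 1 else v]" for i
  let ?P = "\<lambda>ys t. measure_pmf.prob (run A (persistent_adv ((!) ys)) ys t)"
  have "\<forall>\<^sub>F t in sequentially. \<forall>ys\<in>insert xs (flip ` {..<n}).
      5/8 \<le> ?P ys t (correct_states v ys)"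
    using correct
    by (intro eventually_ball_finite ballI solves_threshold_eventually)
      (auto simp: correct_on_all_inputs_def flip_def n_def)
  from eventually_happens'[OF sequentially_bot this] obtain t where success:
    "\<And>ys. ys \<in> insert xs (flip ` {..<n}) \<Longrightarrow> 5/8 \<le> ?P ys t (correct_states v ys)"
    by blast
  have queried: "2 * (5/8) - 1 \<le> ?P xs t {s. responses i (fst s) \<noteq> []}" if "i < n" for i
  proof (rule prob_queried_ge[OF queries_valid])
    show "xs ! j = flip i ! j" if "j \<noteq> i" for j using that by (simp add: flip_def)
    have "i \<in> threshold_set v (flip i) \<longleftrightarrow> i \<notin> threshold_set v xs"
      using \<open>i < n\<close> by (simp add: threshold_set_def flip_def n_def)
    then show "threshold_set v xs \<noteq> threshold_set v (flip i)" by blast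
  qed (use success \<open>i < n\<close> in auto)
  have "ennreal (real n / 4) = ennreal (\<Sum>i<n. 2 * (5/8) - 1)" by simp
  also have "\<dots> \<le> ennreal (\<Sum>i<n. ?P xs t {s. responses i (fst s) \<noteq> []})"
    by (intro ennreal_leI sum_mono queried) auto
  also have "\<dots> \<le> query_complexity A xs" by (rule sum_prob_queried_le_query_complexity)
  finally show ?thesis .
qed

lemma instance_query_complexity_ge_of_correct:
  fixes xs :: "real list" and v :: real
  defines "n \<equiv> length xs" and "k \<equiv> num_ge v xs"
  assumes queries_valid: "algorithm_on n A"
    and correct: "correct_on_all_inputs A v n \<or>
      (0 < k \<and> k < n \<and> correct_given_multiset A v (mset xs))"
  shows "ennreal (1/128 * real n) \<le> instance_query_complexity A xs"
  using correct
proof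
  assume "correct_on_all_inputs A v n"
  then have "ennreal (real n / 4) \<le> query_complexity A xs"
    using query_complexity_ge_of_correct_on_all_inputs[of xs A v] queries_valid by (simp add: n_def)
  also have "\<dots> \<le> instance_query_complexity A xs"
    by (rule query_complexity_le_instance_query_complexity[OF refl])
  finally show ?thesis
    by (rule order_trans[rotated]) (simp add: ennreal_leI)
next
  assume "0 < k \<and> k < n \<and> correct_given_multiset A v (mset xs)"
  then show ?thesis
    using instance_query_complexity_ge_linear[of xs A v] queries_valid by (simp add: n_def k_def)
qed

lemma correct_given_multiset_of_all_inputs:
  "correct_on_all_inputs A v (length xs) \<Longrightarrow> correct_given_multiset A v (mset xs)"
  by (auto simp: correct_on_all_inputs_def correct_given_multiset_def dest: mset_eq_length)

section \<open>Few distinct values\<close>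

lemma eventually_mult_ln_le_powr:
  fixes C e :: real
  assumes "0 < e" "e \<le> 1"
  shows "\<forall>\<^sub>F n :: nat in sequentially.
    C * real n powr (1 - e) * (1 + ln (real n)) + ln 32 \<le> real n powr (1 - e / 2) / 2048"
proof -
  have "(\<lambda>n :: nat. C * (real n powr (1 - e) * (1 + ln (real n)))
      + ln 32) \<in> o(\<lambda>n. real n powr (1 - e / 2))"
    (is "?f \<in> o(?g)")
  proof (intro sum_in_smallo)
    have "(\<lambda>n :: nat. real n powr (1 - e) * (1 + ln (real n))) \<in> o(?g)"
      using assms by real_asymp
    then show "(\<lambda>n :: nat. C * (real n powr (1 - e) * (1 + ln (real n)))) \<in> o(?g)"
      by (cases "C = 0") simp_all
    show "(\<lambda>n :: nat. ln 32) \<in> o(?g)"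
      using assms by real_asymp
  qed
  then have "\<forall>\<^sub>F n in sequentially. norm (?f n) \<le> 1/2048 * norm (?g n)"
    by (rule landau_o.smallD) simp
  then show ?thesis
  proof eventually_elim
    case (elim n)
    have "?f n \<le> norm (?f n)" by simp
    also note elim
    finally show ?case by (simp add: mult.assoc)
  qed
qed

lemma eventually_few_values_negligible:
  fixes C \<epsilon> :: real
  assumes "0 < \<epsilon>"
  defines "d \<equiv> min \<epsilon> 1 / 2"
  shows "\<forall>\<^sub>F n :: nat in sequentially. \<forall>x l p. 1 \<le> x \<longrightarrow> x \<le> real n \<longrightarrow> x powr (- d) \<le> p \<longrightarrow>
    l \<le> C * real n powr (1 - \<epsilon>) \<longrightarrow> l * (1 + ln (real n)) + ln 32 \<le> real n * p / 2048"
proof -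
  have "\<forall>\<^sub>F n :: nat in sequentially. \<bar>C\<bar> * real n powr (1 - min \<epsilon> 1) * (1 + ln (real n)) + ln 32
      \<le> real n powr (1 - d) / 2048"
    unfolding d_def using assms by (intro eventually_mult_ln_le_powr) auto
  then show ?thesis
    using eventually_ge_at_top[of 1]
  proof eventually_elim
    case negligible: (elim n)
    have "l * (1 + ln (real n)) + ln 32 \<le> real n * p / 2048"
      if "1 \<le> x" "x \<le> real n" "x powr (- d) \<le> p" "l \<le> C * real n powr (1 - \<epsilon>)" for x l p
    proof -
      note \<open>l \<le> C * real n powr (1 - \<epsilon>)\<close>
      also have "C * real n powr (1 - \<epsilon>) \<le> \<bar>C\<bar> * real n powr (1 - min \<epsilon> 1)"
        using negligible by (intro mult_mono powr_mono) auto
      finally have "l * (1 + ln (real n)) \<le> \<bar>C\<bar> * real n powr (1 - min \<epsilon> 1) * (1 + ln (real n))"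
        using negligible by (intro mult_right_mono) auto
      also have "\<dots> + ln 32 \<le> real n powr (1 - d) / 2048" by (rule negligible)
      also have "real n powr (1 - d) = real n * real n powr (- d)"
        using negligible powr_add[of "real n" 1 "- d"] by simp
      also have "\<dots> \<le> real n * x powr (- d)"
        using that assms by (intro mult_left_mono powr_mono2') (auto simp: d_def)
      also have "\<dots> \<le> real n * p"
        using that by (intro mult_left_mono) auto
      finally show ?thesis by simp
    qed
    then show ?case by blast
  qed
qed

lemma ex_power_ge_powr_minus:
  fixes d x :: real
  assumes "0 < d" "1 \<le> x"
  shows "\<exists>q. x powr (- d) \<le> (1/3) ^ q \<and> d * ln x / 2 \<le> real (q + 1)"
proof -
  define y where "y = d * log 3 x"
  define q where "q = nat \<lfloor>y\<rfloor>"
  have "0 \<le> y" using assms by (simp add: y_def)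
  then have q_le: "real q \<le> y" and less_q: "y \<le> real (q + 1)" by (auto simp: q_def) linarith
  have "x powr (- d) = 3 powr (- y)"
    using assms by (simp add: y_def powr_def log_def)
  also have "\<dots> \<le> 3 powr (- real q)" using q_le by (intro powr_mono) auto
  also have "\<dots> = (1/3) ^ q" by (simp add: powr_minus powr_realpow power_one_over inverse_eq_divide)
  finally have powr_le: "x powr (- d) \<le> (1/3) ^ q" .
  have "ln 3 \<le> (2 :: real)" using ln_le_minus_one[of 3] by simp
  then have "d * ln x / 2 \<le> d * ln x / ln 3"
    using assms by (intro divide_left_mono) auto
  also have "\<dots> = y" by (simp add: y_def log_def)
  finally have "d * ln x / 2 \<le> real (q + 1)" using less_q by linarith
  with powr_le show ?thesis by blast
qed

lemma sixteen_le_mult_of_powr_le: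
  fixes x y p d :: real
  assumes "256 \<le> x" "x \<le> y" "d \<le> 1/2" "x powr (- d) \<le> p"
  shows "16 \<le> p * y"
proof -
  have "16 = (256 :: real) powr (1/2)" by (simp add: powr_half_sqrt real_sqrt_eq_iff)
  also have "\<dots> \<le> x powr (1/2)" using assms(1) by (intro powr_mono2) auto
  also have "\<dots> \<le> x powr (- d + 1)" using assms by (intro powr_mono) auto
  also have "\<dots> = x powr (- d) * x" using assms(1) by (subst powr_add) simp
  also have "\<dots> \<le> p * y" using assms order_trans[OF powr_ge_zero assms(4)] by (intro mult_mono) auto
  finally show ?thesis .
qed

lemma instance_query_complexity_ge_mult_ln:
  fixes xs :: "real list" and v d :: real
  defines "n \<equiv> length xs" and "m \<equiv> min (num_ge v xs) (length xs - num_ge v xs)"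
  assumes queries_valid: "algorithm_on n A" and correct: "correct_given_multiset A v (mset xs)"
    and d_bounds: "0 < d" "d \<le> 1/2" and m_ge: "256 \<le> m"
    and types: "\<And>p. real m powr (- d) \<le> p \<Longrightarrow>
      real (card (set xs)) * (1 + ln (real n)) + ln 32 \<le> real n * p / 2048"
  shows "ennreal (d / 65536 * (real n * ln (real m))) \<le> instance_query_complexity A xs"
proof -
  obtain q where deceit: "real m powr (- d) \<le> (1/3) ^ q" "d * ln (real m) / 2 \<le> real (q + 1)"
    using ex_power_ge_powr_minus[OF d_bounds(1), of "real m"] m_ge by auto
  have "d / 65536 * (real n * ln (real m)) \<le> real (q + 1) * real n / 32768"
    using mult_right_mono[OF deceit(2), of "real n"] by (simp add: mult_ac)
  then have "ennreal (d / 65536 * (real n * ln (real m))) \<le> ennreal (real (q + 1) * real n / 32768)"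
    by (rule ennreal_leI)
  also have "\<dots> \<le> instance_query_complexity A xs"
    unfolding n_def
  proof (rule instance_query_complexity_ge_deceit_length[OF _ correct])
    show "16 \<le> (1/3) ^ q * real (num_ge v xs)" "16 \<le> (1/3) ^ q * real (length xs - num_ge v xs)"
      using m_ge by (auto simp: m_def intro!: sixteen_le_mult_of_powr_le[OF _ _ d_bounds(2) deceit(1)])
  qed (use queries_valid types[OF deceit(1)] in \<open>simp_all add: n_def\<close>)
  finally show ?thesis .
qed

lemma instance_query_complexity_ge_logarithmic:
  fixes \<epsilon> C :: real
  assumes "0 < \<epsilon>"
  shows "\<exists>M\<ge>3. \<exists>a>0. \<forall>xs v A. algorithm_on (length xs) A \<longrightarrow> correct_given_multiset A v (mset xs) \<longrightarrow>
    real (card (set xs)) \<le> C * real (length xs) powr (1 - \<epsilon>) \<longrightarrow>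
    M \<le> min (num_ge v xs) (length xs - num_ge v xs) \<longrightarrow>
    ennreal (a * (real (length xs) * ln (real (min (num_ge v xs) (length xs - num_ge v xs)))))
      \<le> instance_query_complexity A xs"
proof -
  define d where "d = min \<epsilon> 1 / 2"
  have d_bounds: "0 < d" "d \<le> 1/2" using assms by (auto simp: d_def)
  obtain n\<^sub>0 where negligible: "\<And>n x l p. n\<^sub>0 \<le> n \<Longrightarrow> 1 \<le> x \<Longrightarrow> x \<le> real n \<Longrightarrow> x powr (- d) \<le> p \<Longrightarrow>
      l \<le> C * real n powr (1 - \<epsilon>) \<Longrightarrow> l * (1 + ln (real n)) + ln 32 \<le> real n * p / 2048"
    using eventually_few_values_negligible[OF assms, of C]
    unfolding eventually_sequentially d_def[symmetric] by blast
  show ?thesis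
  proof (intro exI[of _ "max n\<^sub>0 256"] exI[of _ "d / 65536"] conjI allI impI)
    fix xs :: "real list" and v :: real and A
    assume queries_valid: "algorithm_on (length xs) A"
      and correct: "correct_given_multiset A v (mset xs)"
      and few_values: "real (card (set xs)) \<le> C * real (length xs) powr (1 - \<epsilon>)"
      and large: "max n\<^sub>0 256 \<le> min (num_ge v xs) (length xs - num_ge v xs)"
    show "ennreal (d / 65536 * (real (length xs) *
        ln (real (min (num_ge v xs) (length xs - num_ge v xs))))) \<le> instance_query_complexity A xs"
      using large
      by (intro instance_query_complexity_ge_mult_ln queries_valid correct d_bounds
          negligible[OF _ _ _ _ few_values]) auto
  qed (use d_bounds in auto)
qed

lemma ex_const_mult_add_ln_le:
  fixes a b :: real and M :: nat
  assumes "3 \<le> M" "0 < a" "0 < b"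
  shows "\<exists>c>0. \<forall>n m :: nat. c * (real n + real n * ln (real m)) \<le>
    (if m < M then b * real n else a * (real n * ln (real m)))"
proof (intro exI[of _ "min (b / (1 + ln (real M))) (a / 2)"] conjI allI)
  let ?c = "min (b / (1 + ln (real M))) (a / 2)"
  have ln_M: "0 \<le> ln (real M)" using assms(1) by simp
  then have "0 < 1 + ln (real M)" by linarith
  then show "0 < ?c" using assms by simp
  fix n m :: nat
  have ln_m: "0 \<le> ln (real m)" by (cases m) auto
  show "?c * (real n + real n * ln (real m))
      \<le> (if m < M then b * real n else a * (real n * ln (real m)))"
  proof (cases "m < M")
    case True
    then have "ln (real m) \<le> ln (real M)" using ln_M by (cases "m = 0") auto
    then have "?c * (1 + ln (real m)) \<le> b / (1 + ln (real M)) * (1 + ln (real M))"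
      using ln_M ln_m assms by (intro mult_mono) auto
    then have "?c * (1 + ln (real m)) * real n \<le> b * real n"
      using ln_M by (intro mult_right_mono) auto
    then show ?thesis using True by (simp add: algebra_simps)
  next
    case False
    then have "exp 1 \<le> real m" using assms(1) exp_le by linarith
    then have "1 \<le> ln (real m)" using ln_ge_iff[of "real m" 1] False assms(1) by simp
    then have "?c * (1 + ln (real m)) \<le> a / 2 * (2 * ln (real m))"
      using assms by (intro mult_mono min.cobounded2) auto
    then have "?c * (1 + ln (real m)) * real n \<le> a * ln (real m) * real n"
      by (intro mult_right_mono) auto
    then show ?thesis using False by (simp add: algebra_simps)
  qed
qed

theorem mainTheorem6:
  fixes \<epsilon> C :: real
  assumes "\<epsilon> > 0"
  shows "\<exists>c>0. \<forall>(n::nat) (xs::real list) (v::real) (k::nat) (A::algorithm).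
           length xs = n \<longrightarrow>
           real (card (set xs)) \<le> C * real n powr (1 - \<epsilon>) \<longrightarrow>
           k = num_ge v xs \<longrightarrow>
           algorithm_on n A \<longrightarrow>
           correct_on_all_inputs A v n \<or>
             (0 < k \<and> k < n \<and> correct_given_multiset A v (mset xs)) \<longrightarrow>
           (\<exists>ys. mset ys = mset xs \<and>
              ennreal (c * (real n + real n * ln (real (min k (n - k)))))
                \<le> query_complexity A ys)"
proof -
  obtain M a where constants: "3 \<le> M" "0 < a" and logarithmic: "\<forall>xs v A.
      algorithm_on (length xs) A \<longrightarrow> correct_given_multiset A v (mset xs) \<longrightarrow>
      real (card (set xs)) \<le> C * real (length xs) powr (1 - \<epsilon>) \<longrightarrow>
      M \<le> min (num_ge v xs) (length xs - num_ge v xs) \<longrightarrow>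
      ennreal (a * (real (length xs) * ln (real (min (num_ge v xs) (length xs - num_ge v xs)))))
        \<le> instance_query_complexity A xs"
    using instance_query_complexity_ge_logarithmic[OF assms, of C] by blast
  obtain c :: real where "0 < c" and combined: "\<And>n m. c * (real n + real n * ln (real m)) \<le>
      (if m < M then 1/128 * real n else a * (real n * ln (real m)))"
    using ex_const_mult_add_ln_le[OF constants, of "1/128"] by auto
  have "ennreal (c * (real n + real n * ln (real (min k (n - k)))))
      \<le> instance_query_complexity A xs"
    if "length xs = n" "real (card (set xs)) \<le> C * real n powr (1 - \<epsilon>)"
      "k = num_ge v xs" "algorithm_on n A"
      "correct_on_all_inputs A v n \<or> (0 < k \<and> k < n \<and> correct_given_multiset A v (mset xs))"
    for n xs v k A
    by (rule order_trans[OF ennreal_leI[OF combined]])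
      (use that logarithmic instance_query_complexity_ge_of_correct[of xs A v]
        correct_given_multiset_of_all_inputs[of A v xs] in \<open>auto simp: not_less\<close>)
  with \<open>0 < c\<close> show ?thesis by (metis instance_query_complexity_attained)
qed

end
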